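(* In the setting of the context, assume $A:=\varepsilon+\lambda\alpha+\beta_{\mathrm{KL}}>0$. For any $p_0\in\operatorname{int}\Delta^{S-1}$ the flow $$\dot p_i=p_i\Big(\widetilde F_i(p)-\sum_j p_j\widetilde F_j(p)\Big),\qquad i=1,\dots,S,$$ admits a unique global solution $(p_t)_{t\ge0}$ with initial value $p_0$, and it stays in the compact set $\Delta^{S-1}_\delta=\{p\in\Delta^{S-1}:p_i\ge\delta\ \forall i\}$ with $\delta=1/(Se^{M})$. On the affine simplex, $$\nabla^2\widetilde J(p)=-A\,\mathrm{diag}(1/p)-2\lambda\beta K\preceq -A\,I,$$ so $\widetilde J$ is $A$-strongly concave and has a unique maximizer $p^\star\in\operatorname{int}\Delta^{S-1}$. Moreover, $$\frac{d}{dt}\big(\widetilde J(p^\star)-\widetilde J(p_t)\big)\le -2A\delta\,\big(\widetilde J(p^\star)-\widetilde J(p_t)\big)$$ and for all $t\ge 0$ $$\|p_t-p^\star\|_2\le\sqrt{\tfrac{2}{A}\big(\widetilde J(p^\star)-\widetilde J(p_0)\big)}\;e^{-A\delta t}.$$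
   Context: Let $S$ be the (finite) number of traces, $\Delta^{S-1}=\{p\in[0,1]^S:\sum_i p_i=1\}$, $\operatorname{int}\Delta^{S-1}=\{p\in\Delta^{S-1}:\min_i p_i>0\}$. Logarithms are natural. $\widetilde J(p)=\sum_i U_ip_i+\lambda(\alpha H[p]-\beta\,p^\top Kp)-\beta_{\mathrm{KL}}\mathrm{KL}(p\Vert p_{\mathrm{base}})+\varepsilon H[p]$ with $H[p]=-\sum_ip_i\log p_i$, $\mathrm{KL}(p\Vert q)=\sum_ip_i\log(p_i/q_i)$. Assumptions: $|U_i|\le U_{\max}<\infty$; $K\in\mathbb R^{S\times S}$ symmetric positive semidefinite; $\alpha,\beta,\beta_{\mathrm{KL}},\lambda,\varepsilon\ge0$; $p_{\mathrm{base}}\in\Delta^{S-1}$ with $p_{\mathrm{base},\min}:=\min_ip_{\mathrm{base},i}>0$, and $p_{\mathrm{base},\max}:=\max_ip_{\mathrm{base},i}$. $\widetilde F_i(p)=\delta\widetilde J/\delta p_i=U_i-2\lambda\beta(Kp)_i-(\lambda\alpha+\varepsilon)(1+\log p_i)-\beta_{\mathrm{KL}}\big(1+\log\frac{p_i}{p_{\mathrm{base},i}}\big)$. Constants: $\|K\|_{\infty\to\infty}=\max_i\sum_j|K_{ij}|$, $$B:=2U_{\max}+4\lambda\beta\|K\|_{\infty\to\infty}+\beta_{\mathrm{KL}}\log\frac{p_{\mathrm{base},\max}}{p_{\mathrm{base},\min}},\qquad M:=\max\Big\{\max_{i,j}\Big|\log\frac{p_{0,i}}{p_{0,j}}\Big|,\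 \frac BA\Big\}.$$ *)

theory Defs
  imports "HOL-Analysis.Analysis"
begin

text \<open>Vectors in $\mathbb{R}^S$ have type \<open>real ^ 'n\<close>, so \<open>S = CARD('n)\<close>.\<close>

section \<open>The simplex\<close>

definition vec_min :: "real ^ 'n \<Rightarrow> real" where
  "vec_min p = Min (range (\<lambda>i. p $ i))"

definition vec_max :: "real ^ 'n \<Rightarrow> real" where
  "vec_max p = Max (range (\<lambda>i. p $ i))"

definition prob_simplex :: "(real ^ 'n) set" where
  "prob_simplex = {p. (\<forall>i. 0 \<le> p $ i \<and> p $ i \<le> 1) \<and> (\<Sum>i\<in>UNIV. p $ i) = 1}"

definition int_simplex :: "(real ^ 'n) set" where
  "int_simplex = {p \<in> prob_simplex. 0 < vec_min p}"

definition trunc_simplex :: "real \<Rightarrow> (real ^ 'n) set" where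
  "trunc_simplex \<delta> = {p \<in> prob_simplex. \<forall>i. \<delta> \<le> p $ i}"

section \<open>The regularised objective\<close>

text \<open>Since \<open>ln 0 = 0\<close>, the next two definitions incorporate the usual convention
  $0 \log 0 = 0$ at boundary points of the simplex.\<close>

definition entropy :: "real ^ 'n \<Rightarrow> real" where
  "entropy p = - (\<Sum>i\<in>UNIV. p $ i * ln (p $ i))"

definition KL :: "real ^ 'n \<Rightarrow> real ^ 'n \<Rightarrow> real" where
  "KL p q = (\<Sum>i\<in>UNIV. p $ i * ln (p $ i / q $ i))"

definition objective ::
  "real ^ 'n \<Rightarrow> real ^ 'n ^ 'n \<Rightarrow> real \<Rightarrow> real \<Rightarrow> real \<Rightarrow> real \<Rightarrow> real \<Rightarrow> real ^ 'n \<Rightarrow> real ^ 'n \<Rightarrow> real"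
where
  "objective U K lam \<alpha> \<beta> \<beta>KL \<epsilon> pbase p =
     (\<Sum>i\<in>UNIV. U $ i * p $ i) + lam * (\<alpha> * entropy p - \<beta> * (p \<bullet> (K *v p)))
     - \<beta>KL * KL p pbase + \<epsilon> * entropy p"

definition fitness ::
  "real ^ 'n \<Rightarrow> real ^ 'n ^ 'n \<Rightarrow> real \<Rightarrow> real \<Rightarrow> real \<Rightarrow> real \<Rightarrow> real \<Rightarrow> real ^ 'n \<Rightarrow> real ^ 'n \<Rightarrow> real ^ 'n"
where
  "fitness U K lam \<alpha> \<beta> \<beta>KL \<epsilon> pbase p =
     (\<chi> i. U $ i - 2 * lam * \<beta> * (K *v p) $ i - (lam * \<alpha> + \<epsilon>) * (1 + ln (p $ i))
          - \<beta>KL * (1 + ln (p $ i / pbase $ i)))"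

section \<open>Matrices, Hessians, strong concavity\<close>

definition pos_semidef :: "real ^ 'n ^ 'n \<Rightarrow> bool" where
  "pos_semidef K \<longleftrightarrow> transpose K = K \<and> (\<forall>x. 0 \<le> x \<bullet> (K *v x))"

definition loewner_le :: "real ^ 'n ^ 'n \<Rightarrow> real ^ 'n ^ 'n \<Rightarrow> bool" where
  "loewner_le P Q \<longleftrightarrow> pos_semidef (Q - P)"

definition diag_mat :: "real ^ 'n \<Rightarrow> real ^ 'n ^ 'n" where
  "diag_mat v = (\<chi> i j. if i = j then v $ i else 0)"

definition norm_inf_inf :: "real ^ 'n ^ 'n \<Rightarrow> real" where
  "norm_inf_inf K = Max (range (\<lambda>i. \<Sum>j\<in>UNIV. \<bar>K $ i $ j\<bar>))"

text \<open>The Hessian is the derivative of the gradient; both are taken in the ambient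
  space \<open>real ^ 'n\<close>, not only along directions tangent to the simplex.\<close>

definition has_hessian :: "(real ^ 'n \<Rightarrow> real) \<Rightarrow> real ^ 'n ^ 'n \<Rightarrow> real ^ 'n \<Rightarrow> bool" where
  "has_hessian f H p \<longleftrightarrow>
     (\<exists>g. (\<forall>\<^sub>F x in nhds p. GDERIV f x :> g x) \<and> (g has_derivative (\<lambda>h. H *v h)) (at p))"

definition strongly_concave_on :: "'a::real_normed_vector set \<Rightarrow> real \<Rightarrow> ('a \<Rightarrow> real) \<Rightarrow> bool" where
  "strongly_concave_on C m f \<longleftrightarrow> convex C \<and>
     (\<forall>x\<in>C. \<forall>y\<in>C. \<forall>t\<in>{0..1}.
        (1 - t) * f x + t * f y + m / 2 * t * (1 - t) * (norm (x - y))\<^sup>2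
          \<le> f ((1 - t) *\<^sub>R x + t *\<^sub>R y))"

definition is_maximizer_on :: "'a set \<Rightarrow> ('a \<Rightarrow> real) \<Rightarrow> 'a \<Rightarrow> bool" where
  "is_maximizer_on C f x \<longleftrightarrow> x \<in> C \<and> (\<forall>y\<in>C. f y \<le> f x)"

section \<open>The replicator flow\<close>

definition replicator_field :: "(real ^ 'n \<Rightarrow> real ^ 'n) \<Rightarrow> real ^ 'n \<Rightarrow> real ^ 'n" where
  "replicator_field F p = (\<chi> i. p $ i * (F p $ i - (\<Sum>j\<in>UNIV. p $ j * F p $ j)))"

text \<open>The field involves \<open>ln (p $ i)\<close>, so a solution must take values in the open positive
  orthant.  It is not required to lie in the simplex; only its values at \<open>t \<ge> 0\<close> matter, and
  the derivative at \<open>0\<close> is one-sided.\<close>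

definition global_solution ::
  "(real ^ 'n \<Rightarrow> real ^ 'n) \<Rightarrow> real ^ 'n \<Rightarrow> (real \<Rightarrow> real ^ 'n) \<Rightarrow> bool" where
  "global_solution F p0 p \<longleftrightarrow> p 0 = p0 \<and>
     (\<forall>t\<ge>0. (\<forall>i. 0 < p t $ i) \<and>
        (p has_vector_derivative replicator_field F (p t)) (at t within {0..}))"


section \<open>The fitness is the gradient of the objective\<close>

lemma GDERIV_objective:
  assumes K: "transpose K = K" and p: "\<And>i. 0 < p $ i" and pbase: "\<And>i. 0 < pbase $ i"
  shows "GDERIV (objective U K lam \<alpha> \<beta> \<beta>KL \<epsilon> pbase) p :> fitness U K lam \<alpha> \<beta> \<beta>KL \<epsilon> pbase p"
proof -
  have nth: "((\<lambda>p. p $ i) has_derivative (\<lambda>h. h $ i)) (at p)" for i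
    by (rule bounded_linear_imp_has_derivative) (rule bounded_linear_vec_nth)
  have ent_i: "((\<lambda>p. p $ i * ln (p $ i)) has_derivative (\<lambda>h. h $ i * (1 + ln (p $ i)))) (at p)" for i
    using p[of i] by (auto intro!: derivative_eq_intros nth simp: fun_eq_iff field_simps)
  have ent: "(entropy has_derivative (\<lambda>h. - (\<Sum>i\<in>UNIV. h $ i * (1 + ln (p $ i))))) (at p)"
    unfolding entropy_def[abs_def] by (intro has_derivative_minus has_derivative_sum ent_i)
  have kl_i: "((\<lambda>p. p $ i * ln (p $ i / pbase $ i)) has_derivative
      (\<lambda>h. h $ i * (1 + ln (p $ i / pbase $ i)))) (at p)" for i
    using p[of i] pbase[of i] by (auto intro!: derivative_eq_intros nth simp: fun_eq_iff field_simps)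
  have kl: "((\<lambda>p. KL p pbase) has_derivative
      (\<lambda>h. \<Sum>i\<in>UNIV. h $ i * (1 + ln (p $ i / pbase $ i)))) (at p)"
    unfolding KL_def by (intro has_derivative_sum kl_i)
  have Kd: "((*v) K has_derivative (*v) K) (at p)"
    by (rule bounded_linear_imp_has_derivative) (rule matrix_vector_mul_bounded_linear)
  have quad: "((\<lambda>p. p \<bullet> (K *v p)) has_derivative (\<lambda>h. p \<bullet> (K *v h) + h \<bullet> (K *v p))) (at p)"
    by (rule has_derivative_inner[OF has_derivative_ident Kd])
  have symK: "p \<bullet> (K *v h) = h \<bullet> (K *v p)" for h
    using dot_lmul_matrix[of p K h] K by (metis inner_commute transpose_matrix_vector)
  have lin: "((\<lambda>p. \<Sum>i\<in>UNIV. U $ i * p $ i) has_derivative (\<lambda>h. \<Sum>i\<in>UNIV. U $ i * h $ i)) (at p)"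
    by (intro has_derivative_sum has_derivative_mult_right nth)
  have "(objective U K lam \<alpha> \<beta> \<beta>KL \<epsilon> pbase has_derivative
      (\<lambda>h. (\<Sum>i\<in>UNIV. U $ i * h $ i)
        + lam * (\<alpha> * (- (\<Sum>i\<in>UNIV. h $ i * (1 + ln (p $ i))))
            - \<beta> * (p \<bullet> (K *v h) + h \<bullet> (K *v p)))
        - \<beta>KL * (\<Sum>i\<in>UNIV. h $ i * (1 + ln (p $ i / pbase $ i)))
        + \<epsilon> * (- (\<Sum>i\<in>UNIV. h $ i * (1 + ln (p $ i)))))) (at p)"
    unfolding objective_def[abs_def]
    by (intro has_derivative_add has_derivative_diff has_derivative_mult_right lin ent kl quad)
  moreover have "(\<Sum>i\<in>UNIV. U $ i * h $ i)
        + lam * (\<alpha> * (- (\<Sum>i\<in>UNIV. h $ i * (1 + ln (p $ i))))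
            - \<beta> * (p \<bullet> (K *v h) + h \<bullet> (K *v p)))
        - \<beta>KL * (\<Sum>i\<in>UNIV. h $ i * (1 + ln (p $ i / pbase $ i)))
        + \<epsilon> * (- (\<Sum>i\<in>UNIV. h $ i * (1 + ln (p $ i))))
      = h \<bullet> fitness U K lam \<alpha> \<beta> \<beta>KL \<epsilon> pbase p" for h
    unfolding symK unfolding inner_vec_def fitness_def
    by (simp add: algebra_simps sum.distrib sum_subtractf sum_distrib_left sum_negf)
  ultimately show ?thesis
    by (simp add: gderiv_def)
qed

end

(* In the coordinates log (p_i / p_k) the flow is an ODE with a globally Lipschitz right-hand side,
   because softmax is Lipschitz; hence global existence.  Uniqueness follows in the same way once
   the total mass, which obeys a scalar linear ODE, is known to stay equal to 1.
   Each log ratio satisfies r' = w - A r with |w| <= B, so |r| <= M and p_i >= delta.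
   As x log x - x^2/2 is convex on [0,1], the objective is A-strongly concave up to the boundary;
   the gain along the flow is the p-weighted variance of the fitness, at least delta times the
   squared norm of the centred gradient, and the gradient inequality bounds the gap by that norm.
   Gronwall and strong concavity at the maximizer give the rate. *)

theory Submission
  imports Defs "HOL-Real_Asymp.Real_Asymp"
begin

section \<open>Differential equations with Lipschitz right-hand side\<close>

text \<open>The obstacle is \<open>ln (p $ i)\<close>: the replicator field is not Lipschitz near
  the boundary and has no meaning beyond it, while a lower bound on the coordinates can only be
  derived for a solution already at hand. In log coordinates this term becomes linear, positivity is
  automatic, and the mean fitness, common to all coordinates, cancels in differences; so existence
  precedes every a priori bound. Splitting \<open>ln (p/pbase)\<close> merges all entropy terms: the
  objective becomes \<open>b . p - (p . G p)/2 + A * H(p)\<close> with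
  \<open>b_i = U_i + \<beta>KL * ln pbase_i\<close> and \<open>G = 2 lam \<beta> K\<close>. Hence
  \<open>A\<close> is at once the damping rate of the log ratios and the modulus of concavity.
  \<open>B\<close> bounds differences of entries of \<open>b - G p\<close>, and \<open>B / A\<close>
  is the level above which the damping outweighs this drift. The maximizer is sought on the closed
  simplex, where entropy need not be differentiable. Strong concavity therefore comes from scalar
  inequalities with \<open>ln 0 = 0\<close>, and the Hessian bound is proved separately.\<close>

text \<open>The product \<open>f t * exp (- c * t)\<close> has nonpositive derivative. The constant
  \<open>c\<close> may have either sign: it is nonnegative for uniqueness, negative for the log
  ratio bound and the decay rate.\<close>

lemma gronwall_differential:
  fixes f f' :: "real \<Rightarrow> real"
  assumes "0 \<le> T"
    and f': "\<And>t. 0 \<le> t \<Longrightarrow> t \<le> T \<Longrightarrow> (f has_real_derivative f' t) (at t within {0..})"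
    and le: "\<And>t. 0 \<le> t \<Longrightarrow> t \<le> T \<Longrightarrow> f' t \<le> c * f t"
  shows "f T \<le> f 0 * exp (c * T)"
proof -
  let ?g = "\<lambda>t. f t * exp (- c * t)"
  have g': "(?g has_real_derivative (f' t - c * f t) * exp (- c * t)) (at t within {0..})"
    if "0 \<le> t" "t \<le> T" for t
    using f'[OF that] by (auto intro!: derivative_eq_intros simp: algebra_simps)
  have "?g T \<le> ?g 0"
  proof (rule DERIV_nonpos_imp_decreasing_open[OF \<open>0 \<le> T\<close>])
    fix t assume t: "0 < t" "t < T"
    then have "at t within {0..} = at t"
      by (intro at_within_interior) simp
    then have "(?g has_real_derivative (f' t - c * f t) * exp (- c * t)) (at t)"
      using g'[of t] t by simp
    moreover have "(f' t - c * f t) * exp (- c * t) \<le> 0"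
      using le[of t] t by (simp add: mult_nonpos_nonneg)
    ultimately show "\<exists>y. (?g has_real_derivative y) (at t) \<and> y \<le> 0"
      by blast
  next
    show "continuous_on {0..T} ?g"
      unfolding continuous_on_eq_continuous_within
      using g' by (fastforce intro: DERIV_continuous has_field_derivative_subset)
  qed
  then have "f T * exp (- c * T) * exp (c * T) \<le> f 0 * exp (c * T)"
    by simp
  then show ?thesis
    by (simp add: mult.assoc flip: exp_add)
qed

text \<open>Gronwall is applied to the squared distance, which, unlike the distance, is
  differentiable where the two solutions meet.\<close>

lemma lipschitz_ode_unique:
  fixes G :: "'a::real_inner \<Rightarrow> 'a"
  assumes L: "L-lipschitz_on UNIV G"
    and u: "\<And>t. 0 \<le> t \<Longrightarrow> (u has_vector_derivative G (u t)) (at t within {0..})"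
    and v: "\<And>t. 0 \<le> t \<Longrightarrow> (v has_vector_derivative G (v t)) (at t within {0..})"
    and "u 0 = v 0" "0 \<le> t"
  shows "u t = v t"
proof -
  have "(norm (u t - v t))\<^sup>2 \<le> (norm (u 0 - v 0))\<^sup>2 * exp (2 * L * t)"
  proof (rule gronwall_differential[OF \<open>0 \<le> t\<close>])
    fix s :: real assume s: "0 \<le> s"
    have "((\<lambda>t. (u t - v t) \<bullet> (u t - v t)) has_derivative
        (\<lambda>h. (u s - v s) \<bullet> (h *\<^sub>R (G (u s) - G (v s))) + (h *\<^sub>R (G (u s) - G (v s))) \<bullet> (u s - v s)))
        (at s within {0..})"
      using has_vector_derivative_diff[OF u[OF s] v[OF s]]
      unfolding has_vector_derivative_def by (intro has_derivative_inner)
    then show "((\<lambda>t. (norm (u t - v t))\<^sup>2) has_real_derivative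
        2 * ((u s - v s) \<bullet> (G (u s) - G (v s)))) (at s within {0..})"
      unfolding has_field_derivative_def power2_norm_eq_inner
      by (rule has_derivative_eq_rhs) (auto simp: fun_eq_iff inner_commute algebra_simps)
    have "(u s - v s) \<bullet> (G (u s) - G (v s)) \<le> norm (u s - v s) * norm (G (u s) - G (v s))"
      by (rule norm_cauchy_schwarz)
    also have "\<dots> \<le> norm (u s - v s) * (L * norm (u s - v s))"
      by (intro mult_left_mono lipschitz_on_normD[OF L]) auto
    finally show "2 * ((u s - v s) \<bullet> (G (u s) - G (v s))) \<le> 2 * L * (norm (u s - v s))\<^sup>2"
      by (simp add: power2_eq_square algebra_simps)
  qed
  then show ?thesis
    using \<open>u 0 = v 0\<close> by simp
qed

lemma has_vector_derivative_integral_atLeast: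
  fixes f :: "real \<Rightarrow> 'a::banach"
  assumes f: "continuous_on {a..} f" and "a \<le> x"
  shows "((\<lambda>u. integral {a..u} f) has_vector_derivative f x) (at x within {a..})"
proof -
  \<comment> \<open>The compact interval reaches past \<open>x\<close>, so near \<open>x\<close> it
    coincides with the half-line.\<close>
  have "((\<lambda>u. integral {a..u} f) has_vector_derivative f x) (at x within {a..x+1})"
    using \<open>a \<le> x\<close>
    by (intro integral_has_vector_derivative continuous_on_subset[OF f]) auto
  moreover have "at x within {a..x+1} = at x within {a..}"
    by (rule at_within_nhd[where S = "{x-1<..<x+1}"]) auto
  ultimately show ?thesis
    by simp
qed

text \<open>Integrating an exponential bound gains the factor \<open>1 / k\<close>, which turns the
  Lipschitz constant \<open>L\<close> of the Picard map into the contraction factor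
  \<open>L / k\<close>.\<close>

lemma norm_integral_exp_le:
  fixes f :: "real \<Rightarrow> 'a::banach"
  assumes f: "continuous_on {0..t} f" and "0 \<le> t" "0 < k" "0 \<le> C"
    and le: "\<And>s. 0 \<le> s \<Longrightarrow> s \<le> t \<Longrightarrow> norm (f s) \<le> C * exp (k * s)"
  shows "norm (integral {0..t} f) \<le> C / k * exp (k * t)"
proof -
  have I: "((\<lambda>s. C * exp (k * s)) has_integral (C / k * exp (k * t) - C / k * exp (k * 0))) {0..t}"
    using \<open>0 < k\<close>
    by (intro fundamental_theorem_of_calculus \<open>0 \<le> t\<close>)
       (auto intro!: derivative_eq_intros simp flip: has_real_derivative_iff_has_vector_derivative)
  have "norm (integral {0..t} f) \<le> integral {0..t} (\<lambda>s. C * exp (k * s))"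
    using le by (intro integral_norm_bound_integral integrable_continuous_real f continuous_intros) auto
  also have "\<dots> \<le> C / k * exp (k * t)"
    using integral_unique[OF I] \<open>0 < k\<close> \<open>0 \<le> C\<close> by simp
  finally show ?thesis .
qed

text \<open>Picard iteration is a contraction for the weighted norm
  $\sup_{t \ge 0} e^{-kt} \lVert z(t) \rVert$ with $k > L$, so no extension of local
  solutions is needed.\<close>

lemma lipschitz_ode_exists:
  fixes G :: "'a::banach \<Rightarrow> 'a"
  assumes L: "L-lipschitz_on UNIV G"
  obtains z where "z 0 = z0"
    "\<And>t. 0 \<le> t \<Longrightarrow> (z has_vector_derivative G (z t)) (at t within {0..})"
proof -
  \<comment> \<open>Any \<open>k > L\<close> would do; adding 1 also keeps \<open>k\<close> positive
    when \<open>L = 0\<close>.\<close>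
  define k where "k = L + 1"
  have "0 \<le> L" using L by (rule lipschitz_on_nonneg)
  then have "0 < k" by (simp add: k_def)
  have G: "continuous_on X G" for X
    using lipschitz_on_continuous_on[OF L] continuous_on_subset by blast
  \<comment> \<open>A bounded continuous \<open>w\<close> encodes the curve
    \<open>exp (k * s) *\<^sub>R w s\<close>. The weighted norm of the curve is then the sup norm of
    \<open>w\<close>, so completeness comes from the type of bounded continuous functions.\<close>
  define g where "g w s = G (exp (k * s) *\<^sub>R apply_bcontfun w s)" for w s
  have g: "continuous_on X (g w)" for w X
    unfolding g_def by (intro continuous_on_compose2[OF G[of UNIV]] continuous_intros) auto
  \<comment> \<open>This is the Picard map in the rescaled variable. Bounded continuous functions
    live on the whole line, so \<open>max 0 t\<close> freezes the value at negative times.\<close>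
  define P where "P w t = exp (- k * max 0 t) *\<^sub>R (z0 + integral {0..max 0 t} (g w))" for w t
  have I': "((\<lambda>u. integral {0..u} (g w)) has_vector_derivative g w t) (at t within {0..})"
    if "0 \<le> t" for w t
    using that by (intro has_vector_derivative_integral_atLeast g)
  have P_cont: "continuous_on UNIV (P w)" for w
  proof -
    have "continuous_on {0..} (\<lambda>u. integral {0..u} (g w))"
      using I' by (auto simp: continuous_on_eq_continuous_within intro: has_vector_derivative_continuous)
    then have "continuous_on UNIV (\<lambda>t. integral {0..max 0 t} (g w))"
      by (rule continuous_on_compose2) (auto intro!: continuous_intros)
    then show ?thesis
      unfolding P_def by (intro continuous_intros)
  qed
  \<comment> \<open>Linear growth of \<open>G\<close> keeps the integrand below a multiple of
    \<open>exp (k * s)\<close>; after rescaling, the image is bounded and \<open>P w\<close> is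
    again in the space.\<close>
  have P_bound: "norm (P w t) \<le> norm z0 + (norm (G 0) + L * norm w) / k" for w t
  proof -
    let ?t = "max 0 t" and ?C = "norm (G 0) + L * norm w"
    have "norm (integral {0..?t} (g w)) \<le> ?C / k * exp (k * ?t)"
    proof (intro norm_integral_exp_le g \<open>0 < k\<close>)
      fix s :: real assume s: "0 \<le> s"
      have "norm (g w s) \<le> norm (G 0) + norm (g w s - G 0)"
        by (metis add.commute norm_triangle_sub)
      also have "norm (g w s - G 0) \<le> L * (exp (k * s) * norm (apply_bcontfun w s))"
        using lipschitz_on_normD[OF L, of "exp (k * s) *\<^sub>R apply_bcontfun w s" 0] by (simp add: g_def)
      also have "\<dots> \<le> L * (exp (k * s) * norm w)"
        using \<open>0 \<le> L\<close> by (intro mult_left_mono norm_bounded) auto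
      also have "norm (G 0) \<le> norm (G 0) * exp (k * s)"
        using s \<open>0 < k\<close> by (simp add: mult_le_cancel_left1)
      finally show "norm (g w s) \<le> ?C * exp (k * s)"
        by (simp add: algebra_simps)
    qed (use \<open>0 \<le> L\<close> in auto)
    then have "norm (z0 + integral {0..?t} (g w)) \<le> norm z0 + ?C / k * exp (k * ?t)"
      by (meson add_left_mono norm_triangle_le)
    moreover have "norm z0 \<le> norm z0 * exp (k * ?t)"
      using \<open>0 < k\<close> by (simp add: mult_le_cancel_left1)
    ultimately have "norm (z0 + integral {0..?t} (g w)) \<le> (norm z0 + ?C / k) * exp (k * ?t)"
      by (simp add: algebra_simps)
    then have "exp (- (k * ?t)) * norm (z0 + integral {0..?t} (g w))
        \<le> exp (- (k * ?t)) * ((norm z0 + ?C / k) * exp (k * ?t))"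
      by (intro mult_left_mono) auto
    also have "\<dots> = norm z0 + ?C / k"
      by (simp add: exp_minus)
    finally show ?thesis
      by (simp add: P_def)
  qed
  define Q where "Q w = Bcontfun (P w)" for w
  have Q: "apply_bcontfun (Q w) = P w" for w
    unfolding Q_def by (intro Bcontfun_inverse bcontfun_normI[OF P_cont P_bound])
  have "dist (Q v) (Q w) \<le> L / k * dist v w" for v w
  proof (rule dist_bound)
    fix t :: real
    let ?t = "max 0 t"
    have "integral {0..?t} (g v) - integral {0..?t} (g w) = integral {0..?t} (\<lambda>s. g v s - g w s)"
      by (intro integral_diff[symmetric] integrable_continuous_real g)
    also have "norm \<dots> \<le> L * dist v w / k * exp (k * ?t)"
    proof (intro norm_integral_exp_le \<open>0 < k\<close> continuous_intros g)
      fix s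
      have "norm (g v s - g w s) \<le> L * (exp (k * s) * dist (apply_bcontfun v s) (apply_bcontfun w s))"
        unfolding g_def
        by (rule order_trans[OF lipschitz_on_normD[OF L]])
           (auto simp: dist_norm simp flip: scaleR_diff_right)
      also have "\<dots> \<le> L * (exp (k * s) * dist v w)"
        using \<open>0 \<le> L\<close> by (intro mult_left_mono dist_bounded) auto
      finally show "norm (g v s - g w s) \<le> L * dist v w * exp (k * s)"
        by (simp add: algebra_simps)
    qed (use \<open>0 \<le> L\<close> in auto)
    finally have "exp (- (k * ?t)) * norm (integral {0..?t} (g v) - integral {0..?t} (g w))
        \<le> exp (- (k * ?t)) * (L * dist v w / k * exp (k * ?t))"
      by (intro mult_left_mono) auto
    also have "\<dots> = L / k * dist v w"
      by (simp add: exp_minus)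
    finally show "dist (apply_bcontfun (Q v) t) (apply_bcontfun (Q w) t) \<le> L / k * dist v w"
      by (simp add: Q P_def dist_norm flip: scaleR_diff_right)
  qed
  then obtain w where w: "Q w = w"
    using banach_fix_type[of "L / k" Q] \<open>0 \<le> L\<close> by (auto simp: k_def)
  define z where "z t = exp (k * t) *\<^sub>R apply_bcontfun w t" for t
  have z: "z t = z0 + integral {0..t} (g w)" if "0 \<le> t" for t
  proof -
    have "apply_bcontfun w t = P w t"
      using Q[of w] w by simp
    then show ?thesis
      using that by (simp add: z_def P_def flip: exp_add)
  qed
  show thesis
  proof (rule that)
    show "z 0 = z0" using z[of 0] by simp
    fix t :: real assume t: "0 \<le> t"
    have "((\<lambda>u. z0 + integral {0..u} (g w)) has_vector_derivative g w t) (at t within {0..})"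
      using I'[OF t] by (auto intro!: derivative_eq_intros)
    moreover have "g w t = G (z t)"
      by (simp add: g_def z_def)
    ultimately show "(z has_vector_derivative G (z t)) (at t within {0..})"
      using z t by (metis (no_types, lifting) atLeast_iff has_vector_derivative_transform)
  qed
qed

section \<open>The replicator flow in log-ratio coordinates\<close>

lemma has_derivative_vec_componentwise:
  fixes f :: "'a::real_normed_vector \<Rightarrow> real ^ 'n"
  assumes "\<And>i. ((\<lambda>x. f x $ i) has_derivative (\<lambda>h. f' h $ i)) (at a within S)"
  shows "(f has_derivative f') (at a within S)"
  using assms
  by (subst has_derivative_componentwise_within) (auto simp: Basis_vec_def inner_axis)

lemma has_vector_derivative_vec_nth:
  assumes "(f has_vector_derivative f') F"
  shows "((\<lambda>x. f x $ i) has_real_derivative f' $ i) F"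
  using bounded_linear.has_vector_derivative[OF bounded_linear_vec_nth assms]
  by (simp add: has_real_derivative_iff_has_vector_derivative)

lemma has_vector_derivative_vec_componentwise:
  fixes f :: "real \<Rightarrow> real ^ 'n"
  assumes "\<And>i. ((\<lambda>x. f x $ i) has_real_derivative f' $ i) (at a within S)"
  shows "(f has_vector_derivative f') (at a within S)"
  unfolding has_vector_derivative_def
  using assms
  by (intro has_derivative_vec_componentwise)
     (simp add: has_field_derivative_def mult_commute_abs)

text \<open>The constant is crude, coming from the l1 norm; only the existence of some Lipschitz
  constant matters later.\<close>

lemma lipschitz_on_vec_componentwise:
  fixes f :: "'a::metric_space \<Rightarrow> real ^ 'n"
  assumes "\<And>i. L-lipschitz_on X (\<lambda>x. f x $ i)"
  shows "(real CARD('n) * L)-lipschitz_on X f"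
proof (rule lipschitz_onI)
  show "0 \<le> real CARD('n) * L"
    using lipschitz_on_nonneg[OF assms] by simp
  fix x y assume "x \<in> X" "y \<in> X"
  have "dist (f x) (f y) \<le> (\<Sum>i\<in>UNIV. \<bar>f x $ i - f y $ i\<bar>)"
    using norm_le_l1_cart[of "f x - f y"] by (simp add: dist_norm)
  also have "\<dots> \<le> (\<Sum>i::'n\<in>UNIV. L * dist x y)"
    using lipschitz_onD[OF assms \<open>x \<in> X\<close> \<open>y \<in> X\<close>] by (intro sum_mono) (auto simp: dist_real_def)
  finally show "dist (f x) (f y) \<le> real CARD('n) * L * dist x y"
    by simp
qed

section \<open>The softmax map: inversion, derivative, Lipschitz bound\<close>

definition softmax :: "real ^ 'n \<Rightarrow> real ^ 'n" where
  "softmax z = (\<chi> i. exp (z $ i) / (\<Sum>j\<in>UNIV. exp (z $ j)))"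

lemma sum_exp_pos: "0 < (\<Sum>j\<in>UNIV. exp ((z :: real ^ 'n) $ j))"
  by (intro sum_pos) auto

lemma softmax_pos: "0 < softmax z $ i"
  by (simp add: softmax_def sum_exp_pos)

lemma sum_softmax: "(\<Sum>i\<in>UNIV. softmax z $ i) = 1"
  using sum_exp_pos[of z] by (simp add: softmax_def flip: sum_divide_distrib)

lemma ln_softmax: "ln (softmax z $ i) = z $ i - ln (\<Sum>j\<in>UNIV. exp (z $ j))"
  using sum_exp_pos[of z] by (simp add: softmax_def ln_div)

text \<open>Softmax ignores a common shift \<open>c\<close>. The lemma is applied with
  \<open>c = 0\<close> for the initial value and with \<open>c\<close> the logarithm of the
  reference coordinate for log ratios.\<close>

lemma softmax_ln:
  assumes "\<And>i. 0 < p $ i" "(\<Sum>i\<in>UNIV. p $ i) = 1"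
  shows "softmax (\<chi> i. ln (p $ i) - c) = p"
proof -
  have "softmax (\<chi> i. ln (p $ i) - c) $ i = p $ i" for i
  proof -
    have "softmax (\<chi> i. ln (p $ i) - c) $ i = (p $ i / exp c) / (\<Sum>j\<in>UNIV. p $ j / exp c)"
      using assms(1) by (simp add: softmax_def exp_diff)
    then show ?thesis
      using assms(2) by (simp flip: sum_divide_distrib)
  qed
  then show ?thesis by (simp add: vec_eq_iff)
qed

text \<open>The derivative itself has replicator form, a weight times a deviation from the weighted
  mean. This is why softmax carries the log-ratio flow to the replicator flow.\<close>

lemma has_derivative_softmax:
  "((\<lambda>z. softmax z $ i) has_derivative
     (\<lambda>h. softmax z $ i * (h $ i - (\<Sum>j\<in>UNIV. softmax z $ j * h $ j)))) (at z within X)"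
proof -
  let ?s = "\<Sum>j\<in>UNIV. exp (z $ j)"
  have nth: "((\<lambda>z. z $ j) has_derivative (\<lambda>h. h $ j)) (at z within X)" for j
    by (rule bounded_linear_imp_has_derivative) (rule bounded_linear_vec_nth)
  have "((\<lambda>z. exp (z $ i) / (\<Sum>j\<in>UNIV. exp (z $ j))) has_derivative
     (\<lambda>h. (h $ i * exp (z $ i) * ?s - exp (z $ i) * (\<Sum>j\<in>UNIV. h $ j * exp (z $ j))) / (?s * ?s)))
     (at z within X)"
    using sum_exp_pos[of z]
    by (intro has_derivative_divide' has_derivative_sum has_derivative_exp nth) auto
  moreover have "(h $ i * exp (z $ i) * ?s - exp (z $ i) * (\<Sum>j\<in>UNIV. h $ j * exp (z $ j))) / (?s * ?s)
      = softmax z $ i * (h $ i - (\<Sum>j\<in>UNIV. softmax z $ j * h $ j))" for h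
  proof -
    have "(\<Sum>j\<in>UNIV. softmax z $ j * h $ j) = (\<Sum>j\<in>UNIV. h $ j * exp (z $ j)) / ?s"
      by (simp add: softmax_def sum_divide_distrib mult.commute)
    then show ?thesis
      using sum_exp_pos[of z] by (simp add: softmax_def divide_simps) (simp add: algebra_simps)
  qed
  ultimately show ?thesis
    by (simp add: softmax_def)
qed

text \<open>In each coordinate the derivative is a weight at most 1 times the deviation of
  \<open>h $ i\<close> from an average, hence at most \<open>2 * norm h\<close>.\<close>

lemma lipschitz_softmax:
  "(real CARD('n) * 2)-lipschitz_on UNIV (softmax :: real ^ 'n \<Rightarrow> real ^ 'n)"
proof (intro lipschitz_on_vec_componentwise lipschitz_onI)
  fix x y :: "real ^ 'n" and i
  have "norm (softmax x $ i - softmax y $ i) \<le> 2 * norm (x - y)"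
  proof (rule differentiable_bound[OF convex_UNIV has_derivative_softmax])
    fix z :: "real ^ 'n"
    show "onorm (\<lambda>h. softmax z $ i * (h $ i - (\<Sum>j\<in>UNIV. softmax z $ j * h $ j))) \<le> 2"
    proof (rule onorm_le)
      fix h :: "real ^ 'n"
      have "\<bar>\<Sum>j\<in>UNIV. softmax z $ j * h $ j\<bar> \<le> (\<Sum>j\<in>UNIV. softmax z $ j * norm h)"
        by (rule order_trans[OF sum_abs], intro sum_mono)
           (simp add: abs_mult component_le_norm_cart less_imp_le[OF softmax_pos] mult_left_mono)
      also have "\<dots> = norm h"
        by (simp add: sum_softmax flip: sum_distrib_right)
      finally have *: "\<bar>h $ i - (\<Sum>j\<in>UNIV. softmax z $ j * h $ j)\<bar> \<le> 2 * norm h"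
        using component_le_norm_cart[of h i] by linarith
      have "softmax z $ i \<le> (\<Sum>j\<in>UNIV. softmax z $ j)"
        by (intro member_le_sum) (auto simp: less_imp_le[OF softmax_pos])
      then have "\<bar>softmax z $ i\<bar> \<le> 1"
        using softmax_pos[of z i] by (simp add: sum_softmax)
      from mult_mono[OF this *]
      show "norm (softmax z $ i * (h $ i - (\<Sum>j\<in>UNIV. softmax z $ j * h $ j))) \<le> 2 * norm h"
        by (simp add: abs_mult)
    qed
  qed auto
  then show "dist (softmax x $ i) (softmax y $ i) \<le> 2 * dist x y"
    by (simp add: dist_norm)
qed auto

lemma has_vector_derivative_softmax:
  assumes z: "(z has_vector_derivative z') (at t within X)"
  shows "((\<lambda>t. softmax (z t) $ i) has_real_derivative
     softmax (z t) $ i * (z' $ i - (\<Sum>j\<in>UNIV. softmax (z t) $ j * z' $ j))) (at t within X)"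
proof -
  have "((\<lambda>t. softmax (z t) $ i) has_derivative
      (\<lambda>h. softmax (z t) $ i * ((h *\<^sub>R z') $ i - (\<Sum>j\<in>UNIV. softmax (z t) $ j * (h *\<^sub>R z') $ j))))
      (at t within X)"
    by (rule has_derivative_compose[OF z[unfolded has_vector_derivative_def] has_derivative_softmax])
  then show ?thesis
    unfolding has_field_derivative_def
    by (elim has_derivative_eq_rhs) (auto simp: fun_eq_iff algebra_simps sum_distrib_left)
qed

text \<open>A shift common to all fitness values also shifts their mean, and by the same amount
  because the mass is 1.\<close>

lemma replicator_field_cong_const:
  assumes "\<And>i. F p $ i = v $ i + c" "(\<Sum>i\<in>UNIV. p $ i) = 1"
  shows "replicator_field F p $ i = p $ i * (v $ i - (\<Sum>j\<in>UNIV. p $ j * v $ j))"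
  using assms(2)
  by (simp add: replicator_field_def assms(1) distrib_left sum.distrib flip: sum_distrib_right)

section \<open>Conservation of mass and evolution of log ratios\<close>

lemma global_solution_pos: "global_solution F p0 p \<Longrightarrow> 0 \<le> t \<Longrightarrow> 0 < p t $ i"
  by (simp add: global_solution_def)

lemma global_solution_deriv:
  assumes "global_solution F p0 p" "0 \<le> t"
  shows "(p has_vector_derivative replicator_field F (p t)) (at t within {0..})"
  using assms by (simp add: global_solution_def)

text \<open>Solutions are only assumed positive, so this has to be derived. The mass deficit
  \<open>d\<close> satisfies \<open>d' = - m d\<close> with \<open>m\<close> the weighted fitness
  sum, and \<open>m\<close> is bounded on \<open>{0..t}\<close> by continuity and
  compactness.\<close>

lemma global_solution_sum:
  assumes sol: "global_solution F p0 p"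
    and F: "continuous_on {p. \<forall>i. 0 < p $ i} F"
    and p0: "(\<Sum>i\<in>UNIV. p0 $ i) = 1" and "0 \<le> t"
  shows "(\<Sum>i\<in>UNIV. p t $ i) = 1"
proof -
  define m where "m s = (\<Sum>j\<in>UNIV. p s $ j * F (p s) $ j)" for s
  let ?d = "\<lambda>s. 1 - (\<Sum>i\<in>UNIV. p s $ i)"
  have "continuous_on {0..} p"
    using has_vector_derivative_continuous[OF global_solution_deriv[OF sol]]
    by (simp add: continuous_on_eq_continuous_within)
  then have p: "continuous_on {0..t} p"
    by (rule continuous_on_subset) auto
  have "continuous_on {0..t} (\<lambda>s. F (p s))"
    using global_solution_pos[OF sol] by (intro continuous_on_compose2[OF F p]) auto
  then have "continuous_on {0..t} m"
    unfolding m_def by (intro continuous_intros p)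
  then have "bounded (m ` {0..t})"
    by (intro compact_imp_bounded compact_continuous_image) auto
  then obtain C where "\<forall>x\<in>m ` {0..t}. norm x \<le> C"
    unfolding bounded_iff by blast
  then have C: "\<bar>m s\<bar> \<le> C" if "0 \<le> s" "s \<le> t" for s
    using that by simp
  have d': "(?d has_real_derivative - (m s * ?d s)) (at s within {0..})" if "0 \<le> s" for s
  proof -
    have "(?d has_real_derivative 0 - (\<Sum>i\<in>UNIV. replicator_field F (p s) $ i)) (at s within {0..})"
      by (intro DERIV_diff DERIV_const DERIV_sum has_vector_derivative_vec_nth
          global_solution_deriv[OF sol that])
    moreover have "(\<Sum>i\<in>UNIV. replicator_field F (p s) $ i) = m s - (\<Sum>i\<in>UNIV. p s $ i) * m s"
      by (simp add: replicator_field_def m_def right_diff_distrib sum_subtractf sum_distrib_right)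
    ultimately show ?thesis by (simp add: algebra_simps)
  qed
  \<comment> \<open>Squaring the deficit lets a bound on the absolute value of \<open>m\<close>
    suffice, whatever the sign of the deficit.\<close>
  have "(?d t)\<^sup>2 \<le> (?d 0)\<^sup>2 * exp (2 * C * t)"
  proof (rule gronwall_differential[OF \<open>0 \<le> t\<close>])
    fix s assume s: "0 \<le> s" "s \<le> t"
    show "((\<lambda>s. (?d s)\<^sup>2) has_real_derivative 2 * (- m s) * (?d s)\<^sup>2) (at s within {0..})"
      by (rule DERIV_cong[OF DERIV_power[OF d'[OF s(1)], of 2]])
         (simp only: power2_eq_square, simp add: algebra_simps)
    show "2 * (- m s) * (?d s)\<^sup>2 \<le> 2 * C * (?d s)\<^sup>2"
      using C[OF s] by (intro mult_right_mono) auto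
  qed
  moreover have "p 0 = p0"
    using sol by (simp add: global_solution_def)
  ultimately show ?thesis
    using p0 by simp
qed

text \<open>The term \<open>m\<close> enters the growth rate of every coordinate alike and cancels
  in the quotient.\<close>

lemma global_solution_log_ratio_deriv:
  assumes sol: "global_solution F p0 p" and t: "0 \<le> t"
  shows "((\<lambda>t. ln (p t $ i / p t $ j)) has_real_derivative F (p t) $ i - F (p t) $ j)
     (at t within {0..})"
proof -
  have pos: "0 < p t $ i" "0 < p t $ j"
    using global_solution_pos[OF sol t] by auto
  define m where "m = (\<Sum>j\<in>UNIV. p t $ j * F (p t) $ j)"
  have d: "((\<lambda>t. p t $ k) has_real_derivative p t $ k * (F (p t) $ k - m)) (at t within {0..})" for k
    using has_vector_derivative_vec_nth[OF global_solution_deriv[OF sol t], of k]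
    by (simp add: replicator_field_def m_def)
  have "((\<lambda>t. ln (p t $ i / p t $ j)) has_real_derivative
      1 / (p t $ i / p t $ j) * ((p t $ i * (F (p t) $ i - m) * p t $ j
        - p t $ i * (p t $ j * (F (p t) $ j - m))) / (p t $ j * p t $ j))) (at t within {0..})"
    using pos by (intro DERIV_chain2[OF DERIV_ln_divide] DERIV_divide d) auto
  then show ?thesis
    by (rule DERIV_cong) (use pos in \<open>simp add: field_simps\<close>)
qed

text \<open>The normal form of \<open>fitness\<close> on positive vectors, with utilities and base
  distribution absorbed into \<open>b\<close>. For symmetric \<open>G\<close> it is the gradient of
  \<open>entropic_objective\<close>.\<close>

definition entropic_fitness :: "real ^ 'n \<Rightarrow> real ^ 'n ^ 'n \<Rightarrow> real \<Rightarrow> real ^ 'n \<Rightarrow> real ^ 'n" where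
  "entropic_fitness b G a p = (\<chi> i. b $ i - (G *v p) $ i - a * (1 + ln (p $ i)))"

lemma continuous_on_entropic_fitness:
  "continuous_on {p. \<forall>i. 0 < p $ i} (entropic_fitness b G a)"
  unfolding entropic_fitness_def[abs_def]
  by (intro continuous_on_vec_lambda continuous_intros
      bounded_linear.continuous_on[OF matrix_vector_mul_bounded_linear])
     (metis less_irrefl mem_Collect_eq)

text \<open>The flow in the coordinates $z_i = \log (p_i / p_k)$.\<close>

definition log_ratio_field ::
  "'n::finite \<Rightarrow> real ^ 'n \<Rightarrow> real ^ 'n ^ 'n \<Rightarrow> real \<Rightarrow> real ^ 'n \<Rightarrow> real ^ 'n" where
  "log_ratio_field k b G a z =
     (\<chi> i. b $ i - b $ k - ((G *v softmax z) $ i - (G *v softmax z) $ k) - a * (z $ i - z $ k))"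

lemma lipschitz_on_bounded_linear_compose:
  assumes "bounded_linear T" "L-lipschitz_on X f"
  shows "\<exists>M. M-lipschitz_on X (\<lambda>x. T (f x))"
proof -
  obtain B where "B-lipschitz_on (f ` X) T"
    using bounded_linear.lipschitz_boundE[OF assms(1)] by blast
  from lipschitz_on_compose2[OF assms(2) this] show ?thesis by blast
qed

text \<open>The field is a linear map, subtraction of the coordinate \<open>k\<close>, applied to
  \<open>b - G *v softmax z - a *\<^sub>R z\<close>; the logarithm has become the linear last
  term.\<close>

lemma lipschitz_log_ratio_field:
  fixes k :: "'n::finite"
  shows "\<exists>L. L-lipschitz_on UNIV (log_ratio_field k b G a)"
proof -
  have 1: "bounded_linear (\<lambda>x :: real ^ 'n. \<chi> i. x $ i - x $ k)"
    by (simp add: linear_linear linear_iff vec_eq_iff algebra_simps)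
  obtain L1 where L1: "L1-lipschitz_on UNIV (\<lambda>z. G *v softmax z)"
    using lipschitz_on_bounded_linear_compose[OF matrix_vector_mul_bounded_linear lipschitz_softmax]
    by blast
  have "\<exists>L. L-lipschitz_on UNIV (\<lambda>z. b - G *v softmax z - a *\<^sub>R z)"
    using lipschitz_on_diff[OF lipschitz_on_diff[OF lipschitz_on_constant L1]
        lipschitz_on_cmult[OF lipschitz_on_id]] by blast
  then obtain L2 where L2: "L2-lipschitz_on UNIV (\<lambda>z. b - G *v softmax z - a *\<^sub>R z)" ..
  have "log_ratio_field k b G a =
      (\<lambda>z. (\<lambda>x. \<chi> i. x $ i - x $ k) (b - G *v softmax z - a *\<^sub>R z))"
    by (simp add: log_ratio_field_def fun_eq_iff vec_eq_iff algebra_simps)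
  then show ?thesis
    using lipschitz_on_bounded_linear_compose[OF 1 L2] by simp
qed

lemma entropic_flow_exists:
  fixes p0 :: "real ^ 'n"
  assumes p0: "\<And>i. 0 < p0 $ i" "(\<Sum>i\<in>UNIV. p0 $ i) = 1"
  obtains p where "global_solution (entropic_fitness b G a) p0 p"
proof -
  obtain k :: 'n where True by blast
  obtain L where "L-lipschitz_on UNIV (log_ratio_field k b G a)"
    using lipschitz_log_ratio_field by blast
  from lipschitz_ode_exists[OF this] obtain z
    \<comment> \<open>The field depends on \<open>z\<close> only through softmax and differences of
      coordinates, so the start need not vanish at \<open>k\<close>; \<open>- 0\<close> matches the
      shape of \<open>softmax_ln\<close>.\<close>
    where z0: "z 0 = (\<chi> i. ln (p0 $ i) - 0)"
      and z': "\<And>t. 0 \<le> t \<Longrightarrow>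
        (z has_vector_derivative log_ratio_field k b G a (z t)) (at t within {0..})"
    by blast
  have "global_solution (entropic_fitness b G a) p0 (\<lambda>t. softmax (z t))"
    unfolding global_solution_def
  proof (intro conjI allI impI)
    show "softmax (z 0) = p0"
      unfolding z0 by (rule softmax_ln[OF p0])
    fix t :: real assume t: "0 \<le> t"
    show "0 < softmax (z t) $ i" for i
      by (rule softmax_pos)
    show "((\<lambda>t. softmax (z t)) has_vector_derivative
        replicator_field (entropic_fitness b G a) (softmax (z t))) (at t within {0..})"
    proof (rule has_vector_derivative_vec_componentwise)
      fix i
      \<comment> \<open>The constant \<open>c\<close> collects what does not depend on
        \<open>i\<close>: the terms at the reference coordinate \<open>k\<close> and the logarithm
        of the softmax normalizer.\<close>
      have "replicator_field (entropic_fitness b G a) (softmax (z t)) $ i =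
        softmax (z t) $ i * (log_ratio_field k b G a (z t) $ i
          - (\<Sum>j\<in>UNIV. softmax (z t) $ j * log_ratio_field k b G a (z t) $ j))"
        by (rule replicator_field_cong_const[OF _ sum_softmax,
              where c = "b $ k - (G *v softmax (z t)) $ k - a * z t $ k
                - a * (1 - ln (\<Sum>j\<in>UNIV. exp (z t $ j)))"])
           (simp add: entropic_fitness_def log_ratio_field_def ln_softmax algebra_simps)
      then show "((\<lambda>t. softmax (z t) $ i) has_real_derivative
          replicator_field (entropic_fitness b G a) (softmax (z t)) $ i) (at t within {0..})"
        using has_vector_derivative_softmax[OF z'[OF t]] by simp
    qed
  qed
  then show thesis by (rule that)
qed

text \<open>Log ratios determine \<open>p\<close> only up to scaling. Conservation of mass makes
  softmax recover \<open>p\<close> from them, both to close the equation for \<open>u\<close> and to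
  transfer equality back.\<close>

lemma entropic_flow_unique:
  fixes p0 :: "real ^ 'n"
  assumes p: "global_solution (entropic_fitness b G a) p0 p"
    and q: "global_solution (entropic_fitness b G a) p0 q"
    and p0: "(\<Sum>i\<in>UNIV. p0 $ i) = 1" and "0 \<le> t"
  shows "p t = q t"
proof -
  obtain k :: 'n where True by blast
  define u where "u p t = (\<chi> i. ln (p t $ i) - ln (p t $ k))" for p :: "real \<Rightarrow> real ^ 'n" and t :: real
  have softmax_u: "softmax (u p t) = p t"
    if "global_solution (entropic_fitness b G a) p0 p" "0 \<le> t" for p t
    unfolding u_def
    by (intro softmax_ln global_solution_pos[OF that]
        global_solution_sum[OF that(1) continuous_on_entropic_fitness p0 that(2)])
  have u': "(u p has_vector_derivative log_ratio_field k b G a (u p t)) (at t within {0..})"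
    if sol: "global_solution (entropic_fitness b G a) p0 p" and t: "0 \<le> t" for p t
  proof (rule has_vector_derivative_vec_componentwise)
    fix i
    have "u p s $ i = ln (p s $ i / p s $ k)" if "0 \<le> s" for s
      using global_solution_pos[OF sol that, of i] global_solution_pos[OF sol that, of k]
      by (simp add: u_def ln_div)
    moreover have "entropic_fitness b G a (p t) $ i - entropic_fitness b G a (p t) $ k
        = log_ratio_field k b G a (u p t) $ i"
      unfolding log_ratio_field_def softmax_u[OF sol t]
      by (simp add: entropic_fitness_def u_def algebra_simps)
    ultimately show "((\<lambda>t. u p t $ i) has_real_derivative log_ratio_field k b G a (u p t) $ i)
        (at t within {0..})"
      using global_solution_log_ratio_deriv[OF sol t, of i k] t
      by (auto intro: has_field_derivative_transform_within[OF _ zero_less_one])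
  qed
  obtain L where L: "L-lipschitz_on UNIV (log_ratio_field k b G a)"
    using lipschitz_log_ratio_field by blast
  have "u p 0 = u q 0"
    using p q by (simp add: global_solution_def u_def)
  from lipschitz_ode_unique[OF L u'[OF p] u'[OF q] this \<open>0 \<le> t\<close>]
  show ?thesis
    using softmax_u[OF p \<open>0 \<le> t\<close>] softmax_u[OF q \<open>0 \<le> t\<close>] by simp
qed

text \<open>Since \<open>B \<le> a * M\<close>, the excess \<open>r - M\<close> of the log ratio has
  derivative at most \<open>- a * (r - M)\<close> and starts nonpositive, so Gronwall keeps it
  nonpositive. Exchanging \<open>i\<close> and \<open>j\<close> gives the lower bound.\<close>

lemma entropic_flow_log_ratio_le:
  assumes sol: "global_solution (entropic_fitness b G a) p0 p"
    and p0: "(\<Sum>i\<in>UNIV. p0 $ i) = 1" and "0 < a"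
    and B: "\<And>p. p \<in> prob_simplex \<Longrightarrow> b $ i - b $ j - ((G *v p) $ i - (G *v p) $ j) \<le> B"
    and M: "ln (p0 $ i / p0 $ j) \<le> M" "B / a \<le> M" and t: "0 \<le> t"
  shows "ln (p t $ i / p t $ j) \<le> M"
proof -
  let ?r = "\<lambda>t. ln (p t $ i / p t $ j) - M"
  have "?r t \<le> ?r 0 * exp (- a * t)"
  proof (rule gronwall_differential[OF t])
    fix s :: real assume s: "0 \<le> s"
    show "(?r has_real_derivative entropic_fitness b G a (p s) $ i - entropic_fitness b G a (p s) $ j)
        (at s within {0..})"
      using DERIV_diff[OF global_solution_log_ratio_deriv[OF sol s] DERIV_const] by simp
    have pos: "0 < p s $ k" for k
      by (rule global_solution_pos[OF sol s])
    have "p s \<in> prob_simplex"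
    proof -
      have sum: "(\<Sum>i\<in>UNIV. p s $ i) = 1"
        by (rule global_solution_sum[OF sol continuous_on_entropic_fitness p0 s])
      have "p s $ k \<le> (\<Sum>i\<in>UNIV. p s $ i)" for k
        by (intro member_le_sum) (auto simp: less_imp_le[OF pos])
      then show ?thesis
        using sum pos by (auto simp: prob_simplex_def less_imp_le)
    qed
    from B[OF this] have "entropic_fitness b G a (p s) $ i - entropic_fitness b G a (p s) $ j
        \<le> B - a * ln (p s $ i / p s $ j)"
      using pos[of i] pos[of j] by (simp add: entropic_fitness_def ln_div algebra_simps)
    also have "B \<le> a * M"
      using M(2) \<open>0 < a\<close> by (simp add: field_simps)
    finally show "entropic_fitness b G a (p s) $ i - entropic_fitness b G a (p s) $ j
        \<le> - a * ?r s"
      by (simp add: algebra_simps)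
  qed
  also have "\<dots> \<le> 0"
    using M(1) sol by (simp add: global_solution_def mult_nonpos_nonneg)
  finally show ?thesis by simp
qed

text \<open>Summing \<open>p $ i \<le> exp M * p $ j\<close> over \<open>i\<close> gives
  \<open>1 \<le> CARD('n) * exp M * p $ j\<close>, the origin of the constant.\<close>

lemma trunc_simplexI:
  fixes p :: "real ^ 'n"
  assumes pos: "\<And>i. 0 < p $ i" and sum: "(\<Sum>i\<in>UNIV. p $ i) = 1"
    and ratio: "\<And>i j. ln (p $ i / p $ j) \<le> M"
  shows "p \<in> trunc_simplex (1 / (real CARD('n) * exp M))"
proof -
  have "1 / (real CARD('n) * exp M) \<le> p $ j" for j
  proof -
    have "p $ i \<le> exp M * p $ j" for i
    proof -
      have "p $ i / p $ j \<le> exp M"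
        using ratio[of i j] pos[of i] pos[of j] by (metis divide_pos_pos exp_le_cancel_iff exp_ln)
      then show ?thesis
        using pos[of j] by (simp add: field_simps)
    qed
    then have "(\<Sum>i\<in>UNIV. p $ i) \<le> (\<Sum>i::'n\<in>UNIV. exp M * p $ j)"
      by (intro sum_mono)
    then show ?thesis
      using sum by (simp add: field_simps)
  qed
  moreover have "p $ i \<le> 1" for i
    using member_le_sum[of i UNIV "($) p"] pos sum by (auto simp: less_imp_le)
  ultimately show ?thesis
    using pos sum by (auto simp: trunc_simplex_def prob_simplex_def less_imp_le)
qed

section \<open>Strong concavity on the simplex\<close>

text \<open>An endpoint at 0 escapes the second derivative test. Here
  \<open>ln t \<le> t - 1\<close> and \<open>y \<le> 1\<close> suffice.\<close>

lemma xlnx_strongly_convex_0: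
  fixes y t :: real
  assumes "0 \<le> y" "y \<le> 1" "0 \<le> t" "t \<le> 1"
  shows "(t * y) * ln (t * y) + t * (1 - t) / 2 * y\<^sup>2 \<le> t * (y * ln y)"
proof (cases "y = 0 \<or> t = 0")
  case False
  then have "0 < y" "0 < t" using assms by auto
  have "ln t \<le> - (1 - t)"
    using ln_le_minus_one[OF \<open>0 < t\<close>] by simp
  also have "\<dots> \<le> - ((1 - t) / 2 * y)"
    using mult_left_mono[of y 1 "(1 - t) / 2"] assms by simp
  finally have "t * y * ln t \<le> t * y * - ((1 - t) / 2 * y)"
    using assms by (intro mult_left_mono) auto
  then show ?thesis
    using \<open>0 < y\<close> \<open>0 < t\<close> by (simp add: ln_mult power2_eq_square algebra_simps)
qed auto

text \<open>The modulus 1 is the minimum of the second derivative \<open>1 / x\<close> on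
  \<open>{0<..1}\<close>.\<close>

lemma xlnx_strongly_convex:
  fixes x y t :: real
  assumes x: "0 \<le> x" "x \<le> 1" and y: "0 \<le> y" "y \<le> 1" and t: "0 \<le> t" "t \<le> 1"
  shows "((1 - t) * x + t * y) * ln ((1 - t) * x + t * y) + t * (1 - t) / 2 * (x - y)\<^sup>2
    \<le> (1 - t) * (x * ln x) + t * (y * ln y)"
proof -
  consider "x = 0" | "y = 0" | "0 < x" "0 < y"
    using x y by fastforce
  then show ?thesis
  proof cases
    case 1
    then show ?thesis using xlnx_strongly_convex_0[OF y t] by simp
  next
    case 2
    then show ?thesis using xlnx_strongly_convex_0[OF x, of "1 - t"] t by (simp add: algebra_simps)
  next
    case 3
    have "convex_on {0<..1} (\<lambda>x :: real. x * ln x - x\<^sup>2 / 2)"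
    proof (rule f''_ge0_imp_convex)
      fix x :: real assume "x \<in> {0<..1}"
      then show "((\<lambda>x. x * ln x - x\<^sup>2 / 2) has_real_derivative ln x + 1 - x) (at x)"
        "((\<lambda>x. ln x + 1 - x) has_real_derivative 1 / x - 1) (at x)" "0 \<le> 1 / x - 1"
        by (auto intro!: derivative_eq_intros simp: field_simps)
    qed (simp add: convex_real_interval)
    from convex_onD[OF this t, of x y] 3 x y show ?thesis
      by (simp add: power2_eq_square field_simps)
  qed
qed

lemma continuous_on_xlnx: "continuous_on {0..} (\<lambda>x :: real. x * ln x)"
  unfolding continuous_on_eq_continuous_within
proof
  fix x :: real assume "x \<in> {0..}"
  then consider "x = 0" | "0 < x" by fastforce
  then show "continuous (at x within {0..}) (\<lambda>x. x * ln x)"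
  proof cases
    case 1
    have "((\<lambda>x :: real. x * ln x) \<longlongrightarrow> 0) (at_right 0)"
      by real_asymp
    then show ?thesis
      unfolding 1 by (simp add: continuous_within at_within_Ici_at_right)
  next
    case 2
    then show ?thesis by (auto intro!: continuous_intros)
  qed
qed

section \<open>Consequences of strong concavity\<close>

lemma strongly_concave_onD:
  assumes "strongly_concave_on C m f" "x \<in> C" "y \<in> C" "0 \<le> t" "t \<le> 1"
  shows "(1 - t) * f x + t * f y + m / 2 * t * (1 - t) * (norm (x - y))\<^sup>2
    \<le> f ((1 - t) *\<^sub>R x + t *\<^sub>R y)"
  using assms unfolding strongly_concave_on_def by simp

text \<open>A point of the segment close to \<open>x\<close> is no better than \<open>x\<close>.
  Dividing the concavity inequality there by \<open>1 - z\<close> and letting \<open>z\<close> tend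
  to 1 gives the full constant.\<close>

lemma strongly_concave_maximizer_dist:
  assumes f: "strongly_concave_on C m f" and x: "is_maximizer_on C f x" and y: "y \<in> C"
  shows "m / 2 * (norm (y - x))\<^sup>2 \<le> f x - f y"
proof (rule field_le_mult_one_interval)
  fix z :: real assume z: "0 < z" "z < 1"
  have C: "convex C" "x \<in> C" using f x by (auto simp: strongly_concave_on_def is_maximizer_on_def)
  then have "z *\<^sub>R x + (1 - z) *\<^sub>R y \<in> C"
    using z y by (intro convexD) auto
  then have "f (z *\<^sub>R x + (1 - z) *\<^sub>R y) \<le> f x"
    using x by (simp add: is_maximizer_on_def)
  moreover have "z * f x + (1 - z) * f y + m / 2 * (1 - z) * z * (norm (x - y))\<^sup>2
      \<le> f (z *\<^sub>R x + (1 - z) *\<^sub>R y)"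
    using strongly_concave_onD[OF f C(2) y, of "1 - z"] z by simp
  ultimately have "(1 - z) * (z * (m / 2 * (norm (y - x))\<^sup>2)) \<le> (1 - z) * (f x - f y)"
    by (simp add: norm_minus_commute algebra_simps)
  then show "z * (m / 2 * (norm (y - x))\<^sup>2) \<le> f x - f y"
    using z by simp
qed

text \<open>The concavity inequality on the segment from \<open>x\<close> to \<open>y\<close> bounds
  difference quotients of \<open>f\<close> at \<open>x\<close>; the limit is one-sided, so
  \<open>y\<close> may lie on the boundary, where \<open>f\<close> has no gradient.\<close>

lemma strongly_concave_gradient_le:
  assumes f: "strongly_concave_on C m f" and x: "x \<in> C" and y: "y \<in> C"
    and g: "GDERIV f x :> g"
  shows "f y \<le> f x + g \<bullet> (y - x) - m / 2 * (norm (y - x))\<^sup>2"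
proof -
  let ?h = "\<lambda>t. f (x + t *\<^sub>R (y - x))"
  have "((\<lambda>t. x + t *\<^sub>R (y - x)) has_derivative (\<lambda>t. t *\<^sub>R (y - x))) (at 0)"
    by (auto intro!: derivative_eq_intros)
  moreover have "(f has_derivative (\<lambda>h. h \<bullet> g)) (at (x + 0 *\<^sub>R (y - x)))"
    using g by (simp add: gderiv_def)
  ultimately have "(?h has_derivative (\<lambda>t. (t *\<^sub>R (y - x)) \<bullet> g)) (at 0)"
    by (rule has_derivative_compose)
  then have "(?h has_real_derivative (y - x) \<bullet> g) (at 0)"
    by (simp add: has_field_derivative_def mult_commute_abs)
  then have "((\<lambda>t. (?h t - f x) / t) \<longlongrightarrow> (y - x) \<bullet> g) (at_right 0)"
    by (auto simp: DERIV_def intro: tendsto_mono[OF at_le])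
  moreover have "((\<lambda>t. f y - f x + m / 2 * (1 - t) * (norm (x - y))\<^sup>2)
      \<longlongrightarrow> f y - f x + m / 2 * (1 - 0) * (norm (x - y))\<^sup>2) (at_right 0)"
    by (intro tendsto_intros)
  moreover have "\<forall>\<^sub>F t in at_right 0.
      f y - f x + m / 2 * (1 - t) * (norm (x - y))\<^sup>2 \<le> (?h t - f x) / t"
  proof (rule eventually_at_rightI[of 0 1])
    fix t :: real assume t: "t \<in> {0<..<1}"
    then have "(1 - t) * f x + t * f y + m / 2 * t * (1 - t) * (norm (x - y))\<^sup>2
        \<le> f ((1 - t) *\<^sub>R x + t *\<^sub>R y)"
      by (intro strongly_concave_onD[OF f x y]) auto
    also have "(1 - t) *\<^sub>R x + t *\<^sub>R y = x + t *\<^sub>R (y - x)"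
      by (simp add: algebra_simps)
    finally show "f y - f x + m / 2 * (1 - t) * (norm (x - y))\<^sup>2 \<le> (?h t - f x) / t"
      using t by (simp add: field_simps)
  qed simp
  ultimately have "f y - f x + m / 2 * (1 - 0) * (norm (x - y))\<^sup>2 \<le> (y - x) \<bullet> g"
    by (intro tendsto_le[OF trivial_limit_at_right_real])
  then show ?thesis
    by (simp add: norm_minus_commute inner_commute)
qed

section \<open>The simplex and the objective in normal form\<close>

lemma prob_simplex_eq: "prob_simplex = {p :: real ^ 'n. (\<forall>i. 0 \<le> p $ i) \<and> (\<Sum>i\<in>UNIV. p $ i) = 1}"
proof -
  have "p $ i \<le> 1" if "\<forall>i. 0 \<le> p $ i" "(\<Sum>i\<in>UNIV. p $ i) = 1" for p :: "real ^ 'n" and i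
    using member_le_sum[of i UNIV "($) p"] that by simp
  then show ?thesis by (auto simp: prob_simplex_def)
qed

lemma vec_min_pos_iff: "0 < vec_min p \<longleftrightarrow> (\<forall>i. 0 < p $ i)"
  by (simp add: vec_min_def)

lemma int_simplex_eq: "int_simplex = {p :: real ^ 'n. (\<forall>i. 0 < p $ i) \<and> (\<Sum>i\<in>UNIV. p $ i) = 1}"
  by (auto simp: int_simplex_def prob_simplex_eq vec_min_pos_iff less_imp_le)

lemma convex_prob_simplex: "convex (prob_simplex :: (real ^ 'n) set)"
  unfolding prob_simplex_eq
  by (auto intro!: convexI simp: sum.distrib simp flip: sum_distrib_left)

lemma compact_trunc_simplex: "compact (trunc_simplex d :: (real ^ 'n) set)"
proof (rule compact_eq_bounded_closed[THEN iffD2], intro conjI)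
  have "norm p \<le> 1" if "p \<in> prob_simplex" for p :: "real ^ 'n"
    using norm_le_l1_cart[of p] that by (simp add: prob_simplex_eq)
  then show "bounded (trunc_simplex d :: (real ^ 'n) set)"
    by (auto simp: bounded_iff trunc_simplex_def)
  show "closed (trunc_simplex d :: (real ^ 'n) set)"
    unfolding trunc_simplex_def prob_simplex_eq mem_Collect_eq
    by (intro closed_Collect_conj closed_Collect_all closed_Collect_le closed_Collect_eq
        continuous_intros)
qed

lemma compact_prob_simplex: "compact (prob_simplex :: (real ^ 'n) set)"
proof -
  have *: "prob_simplex = (trunc_simplex 0 :: (real ^ 'n) set)"
    by (auto simp: trunc_simplex_def prob_simplex_eq)
  show ?thesis unfolding * by (rule compact_trunc_simplex)
qed

definition entropic_objective :: "real ^ 'n \<Rightarrow> real ^ 'n ^ 'n \<Rightarrow> real \<Rightarrow> real ^ 'n \<Rightarrow> real" where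
  "entropic_objective b G a p =
     b \<bullet> p - (p \<bullet> (G *v p)) / 2 + a * entropy p"

lemma continuous_on_entropic_objective:
  "continuous_on prob_simplex (entropic_objective b G a)"
proof -
  have "continuous_on prob_simplex (\<lambda>p :: real ^ 'n. p $ i * ln (p $ i))" for i
    by (rule continuous_on_compose2[OF continuous_on_xlnx])
       (auto simp: prob_simplex_eq intro!: continuous_intros)
  then have "continuous_on prob_simplex (entropy :: real ^ 'n \<Rightarrow> real)"
    unfolding entropy_def[abs_def] by (intro continuous_on_minus continuous_on_sum)
  moreover have "continuous_on prob_simplex ((*v) G)"
    by (intro linear_continuous_on matrix_vector_mul_bounded_linear)
  ultimately show ?thesis
    unfolding entropic_objective_def[abs_def]
    by (intro continuous_on_diff continuous_on_add continuous_on_mult_left continuous_on_inner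
        continuous_on_divide continuous_on_const continuous_on_id) auto
qed

lemma quadratic_form_convex_combination:
  fixes G :: "real ^ 'n ^ 'n" and x y :: "real ^ 'n"
  shows "((1 - t) *\<^sub>R x + t *\<^sub>R y) \<bullet> (G *v ((1 - t) *\<^sub>R x + t *\<^sub>R y)) =
    (1 - t) * (x \<bullet> (G *v x)) + t * (y \<bullet> (G *v y)) - t * (1 - t) * ((x - y) \<bullet> (G *v (x - y)))"
  by (simp add: matrix_vector_right_distrib matrix_vector_mult_diff_distrib
      matrix_vector_mult_scaleR inner_add_left inner_add_right inner_diff_left inner_diff_right
      algebra_simps)

text \<open>The linear part cancels and the quadratic part leaves an exact remainder, nonnegative
  for semidefinite \<open>G\<close>. Both strong concavity and positivity of the maximizer thus
  reduce to estimates of entropy.\<close>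

lemma entropic_objective_convex_combination:
  fixes G :: "real ^ 'n ^ 'n" and x y :: "real ^ 'n"
  shows "entropic_objective b G a ((1 - t) *\<^sub>R x + t *\<^sub>R y) =
    (1 - t) * entropic_objective b G a x + t * entropic_objective b G a y
    + t * (1 - t) * ((x - y) \<bullet> (G *v (x - y))) / 2
    + a * (entropy ((1 - t) *\<^sub>R x + t *\<^sub>R y) - (1 - t) * entropy x - t * entropy y)"
proof -
  define Q where "Q = (x - y) \<bullet> (G *v (x - y))"
  show ?thesis
    unfolding entropic_objective_def quadratic_form_convex_combination
    unfolding Q_def[symmetric] inner_add_right inner_scaleR_right
    by (simp add: field_simps)
qed

lemma strongly_concave_entropic_objective:
  fixes G :: "real ^ 'n ^ 'n"
  assumes G: "pos_semidef G" and "0 \<le> a"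
  shows "strongly_concave_on prob_simplex a (entropic_objective b G a)"
  unfolding strongly_concave_on_def
proof (intro conjI ballI convex_prob_simplex)
  fix x y :: "real ^ 'n" and t :: real
  assume x: "x \<in> prob_simplex" and y: "y \<in> prob_simplex" and t: "t \<in> {0..1}"
  let ?z = "(1 - t) *\<^sub>R x + t *\<^sub>R y"
  have "(\<Sum>i\<in>UNIV. ?z $ i * ln (?z $ i) + t * (1 - t) / 2 * (x $ i - y $ i)\<^sup>2)
      \<le> (\<Sum>i\<in>UNIV. (1 - t) * (x $ i * ln (x $ i)) + t * (y $ i * ln (y $ i)))"
    unfolding vector_add_component vector_scaleR_component real_scaleR_def
    using x y t by (intro sum_mono xlnx_strongly_convex) (auto simp: prob_simplex_def)
  moreover have "(norm (x - y))\<^sup>2 = (\<Sum>i\<in>UNIV. (x $ i - y $ i)\<^sup>2)"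
    unfolding power2_norm_eq_inner inner_vec_def by (simp add: power2_eq_square)
  ultimately have "t * (1 - t) / 2 * (norm (x - y))\<^sup>2
      \<le> entropy ?z - (1 - t) * entropy x - t * entropy y"
    by (simp add: entropy_def sum.distrib sum_distrib_left)
  from mult_left_mono[OF this \<open>0 \<le> a\<close>]
  have "a / 2 * t * (1 - t) * (norm (x - y))\<^sup>2
      \<le> a * (entropy ?z - (1 - t) * entropy x - t * entropy y)"
    by (simp add: mult.assoc)
  moreover have "0 \<le> t * (1 - t) * ((x - y) \<bullet> (G *v (x - y)))"
    using G t by (intro mult_nonneg_nonneg) (auto simp: pos_semidef_def)
  ultimately show "(1 - t) * entropic_objective b G a x + t * entropic_objective b G a y
      + a / 2 * t * (1 - t) * (norm (x - y))\<^sup>2 \<le> entropic_objective b G a ?z"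
    unfolding entropic_objective_convex_combination by linarith
qed

text \<open>Moving a mass $s$ from $p$ towards the uniform distribution gains
  $-\frac{a}{S} s \log s$ at a vanishing coordinate, which dominates the linear losses as
  $s \to 0$.\<close>

lemma entropic_maximizer_pos:
  fixes p :: "real ^ 'n"
  assumes max: "is_maximizer_on prob_simplex (entropic_objective b G a) p"
    and G: "pos_semidef G" and "0 < a"
  shows "0 < p $ k"
proof (rule ccontr)
  let ?J = "entropic_objective b G a"
  define n where "n = real CARD('n)"
  have "0 < n" by (simp add: n_def)
  have p: "p \<in> prob_simplex" using max by (simp add: is_maximizer_on_def)
  assume "\<not> 0 < p $ k"
  with p have pk: "p $ k = 0" by (auto simp: prob_simplex_def intro: antisym)
  define u :: "real ^ 'n" where "u = (\<chi> i. 1 / n)"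
  have u: "u \<in> prob_simplex"
    by (simp add: u_def prob_simplex_eq n_def)
  define D where "D = ?J p - ?J u"
  \<comment> \<open>Chosen so that \<open>- (a / n * ln s)\<close> equals
    \<open>\<bar>D\<bar> + 1\<close>, which exceeds the loss \<open>D\<close> per unit of moved
    mass.\<close>
  define s where "s = exp (- (\<bar>D\<bar> + 1) * n / a)"
  have s: "0 < s" "s < 1"
    using \<open>0 < n\<close> \<open>0 < a\<close> by (auto simp: s_def divide_neg_pos mult_neg_pos)
  let ?q = "(1 - s) *\<^sub>R p + s *\<^sub>R u"
  have "?q \<in> prob_simplex"
    using convexD[OF convex_prob_simplex p u] s by simp
  then have "?J ?q \<le> ?J p"
    using max by (simp add: is_maximizer_on_def)
  \<comment> \<open>At \<open>k\<close> this is an equality, as \<open>?q $ k = s / n\<close> and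
    \<open>p $ k = 0\<close>; the other coordinates use plain convexity.\<close>
  have "?q $ i * ln (?q $ i) \<le> (1 - s) * (p $ i * ln (p $ i)) + s * (u $ i * ln (u $ i))
      + (if i = k then s / n * ln s else 0)" for i
  proof (cases "i = k")
    case True
    then show ?thesis
      using s \<open>0 < n\<close> by (simp add: pk u_def ln_mult ln_div algebra_simps)
  next
    case False
    have "?q $ i * ln (?q $ i) + s * (1 - s) / 2 * (p $ i - u $ i)\<^sup>2
        \<le> (1 - s) * (p $ i * ln (p $ i)) + s * (u $ i * ln (u $ i))"
      unfolding vector_add_component vector_scaleR_component real_scaleR_def
      using p u s by (intro xlnx_strongly_convex) (auto simp: prob_simplex_def)
    moreover have "0 \<le> s * (1 - s) / 2 * (p $ i - u $ i)\<^sup>2"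
      using s by simp
    ultimately have "?q $ i * ln (?q $ i) \<le> (1 - s) * (p $ i * ln (p $ i)) + s * (u $ i * ln (u $ i))"
      by linarith
    then show ?thesis
      using False by simp
  qed
  then have "(\<Sum>i\<in>UNIV. ?q $ i * ln (?q $ i))
      \<le> (\<Sum>i\<in>UNIV. (1 - s) * (p $ i * ln (p $ i)) + s * (u $ i * ln (u $ i))
        + (if i = k then s / n * ln s else 0))"
    by (intro sum_mono)
  then have "- (s / n * ln s) \<le> entropy ?q - (1 - s) * entropy p - s * entropy u"
    by (simp add: entropy_def sum.distrib sum_distrib_left)
  from mult_left_mono[OF this, of a]
  have "- (a * (s / n * ln s)) \<le> a * (entropy ?q - (1 - s) * entropy p - s * entropy u)"
    using \<open>0 < a\<close> by simp
  moreover have "0 \<le> s * (1 - s) * ((p - u) \<bullet> (G *v (p - u)))"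
    using G s by (intro mult_nonneg_nonneg) (auto simp: pos_semidef_def)
  ultimately have "(1 - s) * ?J p + s * ?J u - a * (s / n * ln s) \<le> ?J ?q"
    unfolding entropic_objective_convex_combination by linarith
  with \<open>?J ?q \<le> ?J p\<close> have "s * (- (a / n * ln s)) \<le> s * D"
    by (simp add: D_def algebra_simps)
  then have "- (a / n * ln s) \<le> D"
    using mult_left_le_imp_le s(1) by blast
  moreover have "- (a / n * ln s) = \<bar>D\<bar> + 1"
    using \<open>0 < n\<close> \<open>0 < a\<close> by (simp add: s_def)
  ultimately show False by linarith
qed

text \<open>The inner product equals the sum of \<open>p $ i * (F p $ i - m)\<^sup>2\<close>,
  because the weighted deviations from \<open>m\<close> sum to 0.\<close>

lemma replicator_field_gain:
  assumes p: "p \<in> trunc_simplex d" and "0 \<le> d"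
    and m: "m = (\<Sum>j\<in>UNIV. p $ j * F p $ j)"
  shows "d * (norm (F p - (\<chi> i. m)))\<^sup>2 \<le> F p \<bullet> replicator_field F p"
proof -
  have sum: "(\<Sum>i\<in>UNIV. p $ i) = 1"
    using p by (simp add: trunc_simplex_def prob_simplex_def)
  have "d * (norm (F p - (\<chi> i. m)))\<^sup>2 = (\<Sum>i\<in>UNIV. d * (F p $ i - m)\<^sup>2)"
    unfolding power2_norm_eq_inner inner_vec_def by (simp add: power2_eq_square sum_distrib_left)
  also have "\<dots> \<le> (\<Sum>i\<in>UNIV. p $ i * (F p $ i - m)\<^sup>2)"
    using p by (intro sum_mono mult_right_mono) (auto simp: trunc_simplex_def)
  also have "\<dots> = (\<Sum>i\<in>UNIV. F p $ i * (p $ i * (F p $ i - m)) - m * (p $ i * F p $ i) + m\<^sup>2 * p $ i)"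
    by (intro sum.cong) (auto simp: power2_eq_square algebra_simps)
  also have "\<dots> = F p \<bullet> replicator_field F p - m * (\<Sum>j\<in>UNIV. p $ j * F p $ j) + m\<^sup>2 * (\<Sum>i\<in>UNIV. p $ i)"
    unfolding inner_vec_def replicator_field_def
    by (simp add: sum.distrib sum_subtractf sum_distrib_left m)
  also have "\<dots> = F p \<bullet> replicator_field F p"
    by (simp add: sum m[symmetric] power2_eq_square)
  finally show ?thesis .
qed

text \<open>Polyak-Lojasiewicz inequality along the simplex: the mean fitness may be
  subtracted from the gradient because $y - p$ has total mass zero.\<close>

lemma strongly_concave_gap_le_gain:
  assumes f: "strongly_concave_on prob_simplex m f" and "0 < m"
    and p: "p \<in> trunc_simplex d" and "0 \<le> d" and y: "y \<in> prob_simplex"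
    and g: "GDERIV f p :> F p"
  shows "2 * m * d * (f y - f p) \<le> F p \<bullet> replicator_field F p"
proof -
  define c where "c = (\<Sum>j\<in>UNIV. p $ j * F p $ j)"
  let ?v = "F p - (\<chi> i. c)" and ?w = "y - p"
  have p': "p \<in> prob_simplex" using p by (simp add: trunc_simplex_def)
  have "(\<chi> i. c) \<bullet> ?w = 0"
    using p' y by (simp add: inner_vec_def prob_simplex_def sum_subtractf flip: sum_distrib_left)
  then have "f y - f p \<le> ?v \<bullet> ?w - m / 2 * (norm ?w)\<^sup>2"
    using strongly_concave_gradient_le[OF f p' y g] by (simp add: inner_diff_left)
  then have "2 * m * (f y - f p) \<le> 2 * m * (?v \<bullet> ?w - m / 2 * (norm ?w)\<^sup>2)"
    using \<open>0 < m\<close> by (intro mult_left_mono) auto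
  \<comment> \<open>Completing the square eliminates the unknown displacement
    \<open>y - p\<close>.\<close>
  also have "\<dots> = (norm ?v)\<^sup>2 - (norm (?v - m *\<^sub>R ?w))\<^sup>2"
    unfolding power2_norm_eq_inner
    by (simp only: inner_diff_left inner_diff_right inner_scaleR_left inner_scaleR_right inner_commute)
       (simp add: algebra_simps)
  also have "\<dots> \<le> (norm ?v)\<^sup>2" by simp
  finally have "d * (2 * m * (f y - f p)) \<le> d * (norm ?v)\<^sup>2"
    using \<open>0 \<le> d\<close> by (rule mult_left_mono)
  also have "\<dots> \<le> F p \<bullet> replicator_field F p"
    using replicator_field_gain[of p d c F] p \<open>0 \<le> d\<close> c_def by simp
  finally show ?thesis by (simp add: algebra_simps)
qed

section \<open>The regularised objective\<close>

text \<open>The KL term splits into negative entropy, which adds \<open>\<beta>KL\<close> to the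
  entropy coefficient, and a part linear in \<open>p\<close>, which joins the utilities. With
  \<open>ln 0 = 0\<close> this also holds at vanishing coordinates.\<close>

lemma objective_eq_entropic:
  assumes "\<And>i. 0 < pbase $ i"
  shows "objective U K lam \<alpha> \<beta> \<beta>KL \<epsilon> pbase =
    entropic_objective (\<chi> i. U $ i + \<beta>KL * ln (pbase $ i)) ((2 * lam * \<beta>) *\<^sub>R K)
      (\<epsilon> + lam * \<alpha> + \<beta>KL)"
proof
  fix p
  have "p $ i * ln (p $ i / pbase $ i) = p $ i * ln (p $ i) - ln (pbase $ i) * p $ i" for i
    using assms[of i] by (cases "p $ i = 0") (auto simp: ln_div algebra_simps)
  then have KL: "KL p pbase = - entropy p - (\<Sum>i\<in>UNIV. ln (pbase $ i) * p $ i)"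
    by (simp add: KL_def entropy_def sum_subtractf)
  have "(\<chi> i. U $ i + \<beta>KL * ln (pbase $ i)) \<bullet> p
      = (\<Sum>i\<in>UNIV. U $ i * p $ i) + \<beta>KL * (\<Sum>i\<in>UNIV. ln (pbase $ i) * p $ i)"
    by (simp add: inner_vec_def sum.distrib sum_distrib_left algebra_simps)
  then show "objective U K lam \<alpha> \<beta> \<beta>KL \<epsilon> pbase p =
    entropic_objective (\<chi> i. U $ i + \<beta>KL * ln (pbase $ i)) ((2 * lam * \<beta>) *\<^sub>R K)
      (\<epsilon> + lam * \<alpha> + \<beta>KL) p"
    unfolding objective_def entropic_objective_def KL
    by (simp add: algebra_simps flip: scaleR_matrix_vector_assoc)
qed

lemma fitness_eq_entropic:
  assumes "\<And>i. 0 < pbase $ i" "\<And>i. 0 < p $ i"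
  shows "fitness U K lam \<alpha> \<beta> \<beta>KL \<epsilon> pbase p =
    entropic_fitness (\<chi> i. U $ i + \<beta>KL * ln (pbase $ i)) ((2 * lam * \<beta>) *\<^sub>R K)
      (\<epsilon> + lam * \<alpha> + \<beta>KL) p"
proof -
  have ln: "ln (p $ i / pbase $ i) = ln (p $ i) - ln (pbase $ i)" for i
    using assms(1)[of i] assms(2)[of i] by (simp add: ln_div)
  then show ?thesis
    unfolding fitness_def entropic_fitness_def
    by (simp add: vec_eq_iff ln algebra_simps flip: scaleR_matrix_vector_assoc)
qed

text \<open>A solution evaluates its fitness only at positive vectors, where \<open>fitness\<close>
  and its normal form agree.\<close>

lemma global_solution_cong:
  assumes "\<And>p. (\<And>i. 0 < p $ i) \<Longrightarrow> F p = F' p"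
  shows "global_solution F p0 = global_solution F' p0"
proof -
  have "replicator_field F p = replicator_field F' p" if "\<forall>i. 0 < p $ i" for p
    using assms[of p] that by (simp add: replicator_field_def)
  then show ?thesis
    by (auto simp: global_solution_def fun_eq_iff)
qed

section \<open>The Hessian and its upper bound\<close>

lemma has_derivative_entropic_fitness:
  assumes p: "\<And>i. 0 < p $ i"
  shows "(entropic_fitness b G a has_derivative
    (*v) (- (a *\<^sub>R diag_mat (\<chi> i. 1 / p $ i)) - G)) (at p)"
proof (rule has_derivative_vec_componentwise)
  fix i
  have nth: "((\<lambda>p. p $ i) has_derivative (\<lambda>h. h $ i)) (at p)"
    by (rule bounded_linear_imp_has_derivative) (rule bounded_linear_vec_nth)
  have "((\<lambda>p. (G *v p) $ i) has_derivative (\<lambda>h. (G *v h) $ i)) (at p)"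
    by (rule bounded_linear_imp_has_derivative)
       (intro bounded_linear_compose[OF bounded_linear_vec_nth] matrix_vector_mul_bounded_linear)
  then have "((\<lambda>p. b $ i - (G *v p) $ i - a * (1 + ln (p $ i))) has_derivative
      (\<lambda>h. - (G *v h) $ i - a * (h $ i / p $ i))) (at p)"
    using p[of i] by (auto intro!: derivative_eq_intros nth simp: fun_eq_iff field_simps)
  moreover have "((- (a *\<^sub>R diag_mat (\<chi> i. 1 / p $ i)) - G) *v h) $ i
      = - (G *v h) $ i - a * (h $ i / p $ i)" for h
  proof -
    have "(diag_mat (\<chi> i. 1 / p $ i) *v h) $ i = h $ i / p $ i"
      by (simp add: matrix_vector_mult_def diag_mat_def if_distrib[of "\<lambda>x. x * _"] cong: if_cong)
    moreover have "(- (a *\<^sub>R diag_mat (\<chi> i. 1 / p $ i)) - G) *v h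
        = - (a *\<^sub>R (diag_mat (\<chi> i. 1 / p $ i) *v h)) - G *v h"
      unfolding matrix_vector_mult_diff_rdistrib
      by (simp add: vec_eq_iff matrix_vector_mult_def sum_negf sum_distrib_left algebra_simps)
    ultimately show ?thesis by simp
  qed
  ultimately show "((\<lambda>p. entropic_fitness b G a p $ i) has_derivative
      (\<lambda>h. ((- (a *\<^sub>R diag_mat (\<chi> i. 1 / p $ i)) - G) *v h) $ i)) (at p)"
    by (simp add: entropic_fitness_def)
qed

lemma has_hessian_objective:
  fixes U pbase p :: "real ^ 'n"
  assumes K: "transpose K = K" and pbase: "\<And>i. 0 < pbase $ i" and p: "\<And>i. 0 < p $ i"
  shows "has_hessian (objective U K lam \<alpha> \<beta> \<beta>KL \<epsilon> pbase)
    (- ((\<epsilon> + lam * \<alpha> + \<beta>KL) *\<^sub>R diag_mat (\<chi> i. 1 / p $ i)) - (2 * lam * \<beta>) *\<^sub>R K) p"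
  unfolding has_hessian_def
proof (intro exI conjI)
  \<comment> \<open>The gradient is required on an ambient neighbourhood of \<open>p\<close>, which
    the open positive orthant supplies.\<close>
  have "open {p :: real ^ 'n. \<forall>i. 0 < p $ i}"
    unfolding Collect_all_eq by (intro open_INT ballI open_Collect_less continuous_intros) auto
  then show "\<forall>\<^sub>F x in nhds p. GDERIV (objective U K lam \<alpha> \<beta> \<beta>KL \<epsilon> pbase) x :>
    entropic_fitness (\<chi> i. U $ i + \<beta>KL * ln (pbase $ i)) ((2 * lam * \<beta>) *\<^sub>R K)
      (\<epsilon> + lam * \<alpha> + \<beta>KL) x"
  proof (rule eventually_nhds_in_open[THEN eventually_mono])
    show "p \<in> {p. \<forall>i. 0 < p $ i}" using p by simp
    fix x :: "real ^ 'n" assume "x \<in> {p. \<forall>i. 0 < p $ i}"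
    then have x: "\<And>i. 0 < x $ i" by simp
    show "GDERIV (objective U K lam \<alpha> \<beta> \<beta>KL \<epsilon> pbase) x :>
      entropic_fitness (\<chi> i. U $ i + \<beta>KL * ln (pbase $ i)) ((2 * lam * \<beta>) *\<^sub>R K)
        (\<epsilon> + lam * \<alpha> + \<beta>KL) x"
      using GDERIV_objective[OF K x pbase] fitness_eq_entropic[OF pbase x] by metis
  qed
qed (rule has_derivative_entropic_fitness[OF p])

text \<open>On the simplex \<open>p $ i \<le> 1\<close>, so \<open>diag (1/p)\<close> dominates the
  identity, and \<open>G\<close> only adds to the difference.\<close>

lemma loewner_le_entropic_hessian:
  assumes p: "p \<in> int_simplex" and G: "pos_semidef G" and "0 \<le> a"
  shows "loewner_le (- (a *\<^sub>R diag_mat (\<chi> i. 1 / p $ i)) - G) (- (a *\<^sub>R mat 1))"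
proof -
  let ?D = "diag_mat (\<chi> i. 1 / p $ i)"
  have eq: "- (a *\<^sub>R mat 1) - (- (a *\<^sub>R ?D) - G) = a *\<^sub>R (?D - mat 1) + G"
    by (simp add: algebra_simps)
  have "0 \<le> x \<bullet> ((a *\<^sub>R (?D - mat 1) + G) *v x)" for x
  proof -
    have "1 \<le> 1 / p $ i" for i
      using p by (simp add: int_simplex_def prob_simplex_def vec_min_pos_iff)
    then have "0 \<le> (\<Sum>i\<in>UNIV. (1 / p $ i - 1) * (x $ i)\<^sup>2)"
      by (intro sum_nonneg mult_nonneg_nonneg) auto
    also have "\<dots> = x \<bullet> ((?D - mat 1) *v x)"
    proof -
      have "(?D *v x) $ i = x $ i / p $ i" for i
        by (simp add: matrix_vector_mult_def diag_mat_def if_distrib[of "\<lambda>x. x * _"] cong: if_cong)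
      then show ?thesis
        by (simp add: matrix_vector_mult_diff_rdistrib inner_vec_def power2_eq_square algebra_simps)
    qed
    finally have "0 \<le> a * (x \<bullet> ((?D - mat 1) *v x))"
      using \<open>0 \<le> a\<close> by simp
    moreover have "0 \<le> x \<bullet> (G *v x)"
      using G by (simp add: pos_semidef_def)
    ultimately show ?thesis
      by (simp add: matrix_vector_mult_add_rdistrib inner_add_right flip: scaleR_matrix_vector_assoc)
  qed
  moreover have "transpose (a *\<^sub>R (?D - mat 1) + G) = a *\<^sub>R (?D - mat 1) + G"
    using G by (auto simp: pos_semidef_def transpose_def vec_eq_iff diag_mat_def mat_def)
  ultimately show ?thesis
    by (simp add: loewner_le_def pos_semidef_def eq)
qed

lemma pos_semidef_scaleR:
  assumes "pos_semidef K" "0 \<le> c"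
  shows "pos_semidef (c *\<^sub>R K)"
  using assms
  by (auto simp: pos_semidef_def transpose_def vec_eq_iff simp flip: scaleR_matrix_vector_assoc)

lemma abs_matrix_vector_le_norm_inf_inf:
  assumes p: "p \<in> prob_simplex"
  shows "\<bar>(K *v p) $ i\<bar> \<le> norm_inf_inf K"
proof -
  have "\<bar>(K *v p) $ i\<bar> \<le> (\<Sum>j\<in>UNIV. \<bar>K $ i $ j * p $ j\<bar>)"
    unfolding matrix_vector_mult_def by (simp add: sum_abs)
  also have "\<dots> \<le> (\<Sum>j\<in>UNIV. \<bar>K $ i $ j\<bar>)"
    using p by (intro sum_mono) (auto simp: abs_mult prob_simplex_def mult_left_le)
  also have "\<dots> \<le> norm_inf_inf K"
    unfolding norm_inf_inf_def by (rule Max_ge) auto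
  finally show ?thesis .
qed

lemma ln_diff_le_ln_max_div_min:
  assumes "\<And>i. 0 < q $ i"
  shows "ln (q $ i) - ln (q $ j) \<le> ln (vec_max q / vec_min q)"
proof -
  have min: "0 < vec_min q" "vec_min q \<le> q $ j" and max: "q $ i \<le> vec_max q"
    using assms by (auto simp: vec_min_pos_iff vec_min_def vec_max_def)
  moreover have "0 < vec_max q"
    using max assms[of i] by linarith
  ultimately show ?thesis
    using assms by (simp add: ln_div diff_mono)
qed

theorem theoremA1:
  fixes U pbase p0 :: "real ^ 'n" and K :: "real ^ 'n ^ 'n"
    and Umax lam \<alpha> \<beta> \<beta>KL \<epsilon> A B M \<delta> :: real
    and J :: "real ^ 'n \<Rightarrow> real" and F :: "real ^ 'n \<Rightarrow> real ^ 'n"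
  assumes U: "\<forall>i. \<bar>U $ i\<bar> \<le> Umax"
    and K: "pos_semidef K"
    and nonneg: "0 \<le> \<alpha>" "0 \<le> \<beta>" "0 \<le> \<beta>KL" "0 \<le> lam" "0 \<le> \<epsilon>"
    and pbase: "pbase \<in> prob_simplex" "0 < vec_min pbase"
    and J: "J = objective U K lam \<alpha> \<beta> \<beta>KL \<epsilon> pbase"
    and F: "F = fitness U K lam \<alpha> \<beta> \<beta>KL \<epsilon> pbase"
    and A: "A = \<epsilon> + lam * \<alpha> + \<beta>KL"
    and A_pos: "0 < A"
    and p0: "p0 \<in> int_simplex"
    and B: "B = 2 * Umax + 4 * lam * \<beta> * norm_inf_inf K + \<beta>KL * ln (vec_max pbase / vec_min pbase)"
    and M: "M = max (Max (range (\<lambda>(i, j). \<bar>ln (p0 $ i / p0 $ j)\<bar>))) (B / A)"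
    and \<delta>: "\<delta> = 1 / (real CARD('n) * exp M)"
  shows
    "(\<forall>p\<in>int_simplex.
        has_hessian J (- (A *\<^sub>R diag_mat (\<chi> i. 1 / p $ i)) - (2 * lam * \<beta>) *\<^sub>R K) p \<and>
        loewner_le (- (A *\<^sub>R diag_mat (\<chi> i. 1 / p $ i)) - (2 * lam * \<beta>) *\<^sub>R K) (- (A *\<^sub>R mat 1))) \<and>
     strongly_concave_on prob_simplex A J \<and>
     (\<exists>pstar.
        is_maximizer_on prob_simplex J pstar \<and>
        (\<forall>q. is_maximizer_on prob_simplex J q \<longrightarrow> q = pstar) \<and>
        pstar \<in> int_simplex \<and>
        (\<exists>p.
           global_solution F p0 p \<and>
           (\<forall>q. global_solution F p0 q \<longrightarrow> (\<forall>t\<ge>0. q t = p t)) \<and>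
           compact (trunc_simplex \<delta> :: (real ^ 'n) set) \<and>
           (\<forall>t\<ge>0. p t \<in> trunc_simplex \<delta>) \<and>
           (\<forall>t\<ge>0. \<exists>D.
              ((\<lambda>s. J pstar - J (p s)) has_real_derivative D) (at t within {0..}) \<and>
              D \<le> - 2 * A * \<delta> * (J pstar - J (p t))) \<and>
           (\<forall>t\<ge>0. norm (p t - pstar) \<le> sqrt (2 / A * (J pstar - J p0)) * exp (- A * \<delta> * t))))"
proof -
  define b where "b = (\<chi> i. U $ i + \<beta>KL * ln (pbase $ i))"
  define G where "G = (2 * lam * \<beta>) *\<^sub>R K"
  have pb: "0 < pbase $ i" for i
    using pbase by (simp add: vec_min_pos_iff)
  have J_eq: "J = entropic_objective b G A"
    unfolding J b_def G_def A by (rule objective_eq_entropic[OF pb])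
  have sol_eq: "global_solution F p0 = global_solution (entropic_fitness b G A) p0"
    unfolding F b_def G_def A by (intro global_solution_cong fitness_eq_entropic pb)
  have G: "pos_semidef G"
    unfolding G_def using nonneg by (intro pos_semidef_scaleR K) simp
  have p0': "0 < p0 $ i" "(\<Sum>i\<in>UNIV. p0 $ i) = 1" for i
    using p0 by (auto simp: int_simplex_eq)
  have grad: "GDERIV J p :> F p" if "\<And>i. 0 < p $ i" for p
    unfolding J F using K that pb by (intro GDERIV_objective) (auto simp: pos_semidef_def)
  have conc: "strongly_concave_on prob_simplex A J"
    unfolding J_eq using A_pos by (intro strongly_concave_entropic_objective G) simp
  have "0 < \<delta>" by (simp add: \<delta>)

  obtain pstar where max: "is_maximizer_on prob_simplex J pstar"
    using continuous_attains_sup[OF compact_prob_simplex _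
        continuous_on_entropic_objective, of b G A] p0
    unfolding is_maximizer_on_def J_eq by (auto simp: int_simplex_def)
  have gap: "A / 2 * (norm (q - pstar))\<^sup>2 \<le> J pstar - J q" if "q \<in> prob_simplex" for q
    by (rule strongly_concave_maximizer_dist[OF conc max that])
  have max_unique: "q = pstar" if "is_maximizer_on prob_simplex J q" for q
  proof -
    have "J pstar \<le> J q" "q \<in> prob_simplex"
      using that max by (auto simp: is_maximizer_on_def)
    then have "A / 2 * (norm (q - pstar))\<^sup>2 \<le> 0"
      using gap[of q] by linarith
    then show ?thesis
      using A_pos by (simp add: mult_le_0_iff)
  qed
  have "0 < pstar $ i" for i
    using entropic_maximizer_pos[OF max[unfolded J_eq] G A_pos] .
  then have star_int: "pstar \<in> int_simplex"
    using max by (simp add: int_simplex_def vec_min_pos_iff is_maximizer_on_def)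

  obtain p where sol: "global_solution F p0 p"
    unfolding sol_eq using entropic_flow_exists[OF p0'] by metis
  have unique: "q t = p t" if "global_solution F p0 q" "0 \<le> t" for q t
    using entropic_flow_unique that sol p0'(2) unfolding sol_eq by metis

  \<comment> \<open>The three terms of \<open>B\<close> bound three differences: utilities give
    \<open>2 * Umax\<close>, two entries of \<open>2 lam \<beta> K q\<close> give the factor 4, and
    the base distribution gives the log quotient.\<close>
  have drift: "b $ i - b $ j - ((G *v q) $ i - (G *v q) $ j) \<le> B" if "q \<in> prob_simplex" for q i j
  proof -
    have "\<bar>(K *v q) $ i - (K *v q) $ j\<bar> \<le> 2 * norm_inf_inf K"
      using abs_matrix_vector_le_norm_inf_inf[OF that, of K i]
        abs_matrix_vector_le_norm_inf_inf[OF that, of K j] by linarith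
    then have "- ((K *v q) $ i - (K *v q) $ j) \<le> 2 * norm_inf_inf K"
      by linarith
    then have "2 * lam * \<beta> * - ((K *v q) $ i - (K *v q) $ j) \<le> 2 * lam * \<beta> * (2 * norm_inf_inf K)"
      using nonneg by (intro mult_left_mono) auto
    moreover have "\<beta>KL * (ln (pbase $ i) - ln (pbase $ j))
        \<le> \<beta>KL * ln (vec_max pbase / vec_min pbase)"
      using nonneg by (intro mult_left_mono ln_diff_le_ln_max_div_min pb) auto
    moreover have "U $ i - U $ j \<le> 2 * Umax"
      using U[rule_format, of i] U[rule_format, of j] by linarith
    ultimately show ?thesis
      unfolding B b_def G_def by (simp add: algebra_simps flip: scaleR_matrix_vector_assoc)
  qed
  have M_ge: "ln (p0 $ i / p0 $ j) \<le> M" for i j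
  proof -
    have "\<bar>ln (p0 $ i / p0 $ j)\<bar> \<le> Max (range (\<lambda>(i, j). \<bar>ln (p0 $ i / p0 $ j)\<bar>))"
      by (rule Max_ge) (auto intro!: image_eqI[where x = "(i, j)"])
    then show ?thesis unfolding M by linarith
  qed
  have pos: "0 < p t $ i" if "0 \<le> t" for t i
    by (rule global_solution_pos[OF sol that])
  have trunc: "p t \<in> trunc_simplex \<delta>" if t: "0 \<le> t" for t
    unfolding \<delta>
  proof (rule trunc_simplexI)
    show "(\<Sum>i\<in>UNIV. p t $ i) = 1"
      by (rule global_solution_sum[OF sol[unfolded sol_eq] continuous_on_entropic_fitness p0'(2) t])
    show "ln (p t $ i / p t $ j) \<le> M" for i j
      by (rule entropic_flow_log_ratio_le[OF sol[unfolded sol_eq] p0'(2) A_pos drift M_ge _ t])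
         (simp_all add: M)
  qed (rule pos[OF t])

  define D where "D t = - (F (p t) \<bullet> replicator_field F (p t))" for t
  have D: "((\<lambda>s. J pstar - J (p s)) has_real_derivative D t) (at t within {0..})" if t: "0 \<le> t" for t
  proof -
    have "((\<lambda>s. J (p s)) has_derivative (\<lambda>h. (h *\<^sub>R replicator_field F (p t)) \<bullet> F (p t)))
        (at t within {0..})"
      using global_solution_deriv[OF sol t] grad[OF pos[OF t]]
      unfolding has_vector_derivative_def gderiv_def by (rule has_derivative_compose)
    then have "((\<lambda>s. J (p s)) has_real_derivative F (p t) \<bullet> replicator_field F (p t))
        (at t within {0..})"
      by (simp add: has_field_derivative_def mult_commute_abs inner_commute)
    from DERIV_diff[OF DERIV_const this] show ?thesis by (simp add: D_def)
  qed
  have D_le: "D t \<le> - 2 * A * \<delta> * (J pstar - J (p t))" if t: "0 \<le> t" for t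
    using strongly_concave_gap_le_gain[where F = F and y = pstar,
        OF conc A_pos trunc[OF t] _ _ grad[OF pos[OF t]]]
      \<open>0 < \<delta>\<close> max by (simp add: D_def is_maximizer_on_def)

  have rate: "norm (p t - pstar) \<le> sqrt (2 / A * (J pstar - J p0)) * exp (- A * \<delta> * t)"
    if t: "0 \<le> t" for t
  proof -
    \<comment> \<open>The gap decays at rate \<open>2 * A * \<delta>\<close>; the square root taken
      when passing to the norm halves the exponent.\<close>
    have "J pstar - J (p t) \<le> (J pstar - J (p 0)) * exp (- 2 * A * \<delta> * t)"
      using gronwall_differential[OF t D D_le] by simp
    also have "p 0 = p0"
      using sol by (simp add: global_solution_def)
    also have "exp (- 2 * A * \<delta> * t) = (exp (- A * \<delta> * t))\<^sup>2"
      by (simp flip: exp_double)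
    finally have "2 / A * (J pstar - J (p t)) \<le> 2 / A * ((J pstar - J p0) * (exp (- A * \<delta> * t))\<^sup>2)"
      using A_pos by (intro mult_left_mono) auto
    moreover have "(norm (p t - pstar))\<^sup>2 \<le> 2 / A * (J pstar - J (p t))"
      using gap[of "p t"] trunc[OF t] A_pos by (simp add: trunc_simplex_def field_simps)
    ultimately have "(norm (p t - pstar))\<^sup>2 \<le> 2 / A * (J pstar - J p0) * (exp (- A * \<delta> * t))\<^sup>2"
      by (simp only: mult.assoc)
    from real_le_rsqrt[OF this] show ?thesis
      by (simp only: real_sqrt_mult real_sqrt_abs abs_exp_cancel)
  qed

  have decay: "\<exists>D'. ((\<lambda>s. J pstar - J (p s)) has_real_derivative D') (at t within {0..}) \<and>
      D' \<le> - 2 * A * \<delta> * (J pstar - J (p t))" if "0 \<le> t" for t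
    using D[OF that] D_le[OF that] by blast
  have hess: "has_hessian J (- (A *\<^sub>R diag_mat (\<chi> i. 1 / q $ i)) - (2 * lam * \<beta>) *\<^sub>R K) q"
    if "q \<in> int_simplex" for q
    unfolding J A using K that pb
    by (intro has_hessian_objective) (auto simp: pos_semidef_def int_simplex_eq)
  have loewner: "loewner_le (- (A *\<^sub>R diag_mat (\<chi> i. 1 / q $ i)) - (2 * lam * \<beta>) *\<^sub>R K)
      (- (A *\<^sub>R mat 1))" if "q \<in> int_simplex" for q
    using loewner_le_entropic_hessian[OF that G] A_pos by (simp add: G_def)
  show ?thesis
    by (intro conjI ballI allI impI exI[of _ pstar] exI[of _ p])
       (rule hess loewner conc max max_unique star_int sol unique compact_trunc_simplex trunc
          decay rate, (assumption+)?)+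
qed

thm_deps theoremA1

end
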